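(* Let $G$ be an $n$-vertex graph with diameter $2$. If $G$ has no cut-vertex (in particular, if $G$ is Class 0), then $e(G)\ge 2n-5$. Further, equality holds if and only if $G$ is (isomorphic to) the Petersen graph, or a graph $F_{p,q}$ for some positive integers $p,q$, or a graph $G_{p,q,r}$ for some positive integers $p,q,r$.
   Context: Graphs are finite, simple and connected; $e(G)$ is the number of edges of $G$. Families: $F_{p,q}$ (with $p,q$ positive integers) is formed from $K_3$ by choosing a vertex $v$, replacing the two edges incident to $v$ with $p$ parallel edges and $q$ parallel edges respectively, and then subdividing each of these $p+q$ new edges exactly once. $G_{p,q,r}$ (with $p,q,r$ positive integers) is formed from $K_4$ by choosing a vertex $v$, replacing the three edges incident to $v$ with $p$, $q$, and $r$ parallel edges respectively, and then subdividing each of these $p+q+r$ new edges exactly once. Pebbling: A configuration on $G$ is a function $p:V(G)\to\mathbb{N}\cup\{0\}$; its size is $|p|=\sum_{v}p(v)$. A pebbling move removes two pebbles from some vertex and places one pebble on an adjacent vertex. For a root $r\in V(G)$, $p$ is solvable for $(G,r)$ if some (possibly empty) sequence of pebbling moves from $p$ yields a configuration with at least one pebble on $r$. The pebbling number $\pi(G)$ is the least integer $k$ such that for every vertex $v$, every configuration of size $k$ is solvable for $(G,v)$. $G$ is Class 0 if $\pi(G)=|V(G)|$. *)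

theory Defs
  imports "Graph_Theory.Graph_Theory"
begin

text \<open>
  A finite simple graph is a term \<open>G\<close> with \<^const>\<open>pair_graph\<close> \<open>G\<close>, that is, a finite vertex set
  \<open>pverts G\<close> with a symmetric irreflexive relation \<open>parcs G\<close> on it. Every edge occurs in
  \<open>parcs G\<close> in both directions, so edges are counted as two-element sets.
\<close>

definition edges :: "'a pair_pre_digraph \<Rightarrow> 'a set set" where
  "edges G = (\<lambda>(u, v). {u, v}) ` parcs G"

definition graph_dist :: "'a pair_pre_digraph \<Rightarrow> 'a \<Rightarrow> 'a \<Rightarrow> ereal" where
  "graph_dist G u v = wf_digraph.\<mu> (with_proj G) (\<lambda>_. 1) u v"

definition diameter :: "'a pair_pre_digraph \<Rightarrow> ereal" where
  "diameter G = (SUP u\<in>pverts G. SUP v\<in>pverts G. graph_dist G u v)"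

text \<open>
  For connected \<open>G\<close>. The graph without vertices is not \<^const>\<open>connected\<close>; the second conjunct
  keeps the vertex of a one-vertex graph from being a cut-vertex.
\<close>

definition cut_vertex :: "'a pair_pre_digraph \<Rightarrow> 'a \<Rightarrow> bool" where
  "cut_vertex G v \<longleftrightarrow> v \<in> pverts G \<and> pverts G \<noteq> {v} \<and>
     \<not> connected (pre_digraph.del_vert (with_proj G) v)"

definition has_cut_vertex :: "'a pair_pre_digraph \<Rightarrow> bool" where
  "has_cut_vertex G \<longleftrightarrow> (\<exists>v. cut_vertex G v)"


subsection \<open>Pebbling\<close>

text \<open>
  A configuration is a function on the whole vertex type. Its values outside \<open>pverts G\<close> are
  irrelevant: they do not count towards the size, and no move touches them.
\<close>

definition config_size :: "'a pair_pre_digraph \<Rightarrow> ('a \<Rightarrow> nat) \<Rightarrow> nat" where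
  "config_size G c = (\<Sum>v\<in>pverts G. c v)"

inductive pebbling_move :: "'a pair_pre_digraph \<Rightarrow> ('a \<Rightarrow> nat) \<Rightarrow> ('a \<Rightarrow> nat) \<Rightarrow> bool"
  for G where
  "(u, v) \<in> parcs G \<Longrightarrow> 2 \<le> c u \<Longrightarrow> pebbling_move G c (c(u := c u - 2, v := c v + 1))"

definition solvable :: "'a pair_pre_digraph \<Rightarrow> 'a \<Rightarrow> ('a \<Rightarrow> nat) \<Rightarrow> bool" where
  "solvable G r c \<longleftrightarrow> (\<exists>c'. (pebbling_move G)\<^sup>*\<^sup>* c c' \<and> 1 \<le> c' r)"

definition pebbling_number :: "'a pair_pre_digraph \<Rightarrow> nat" where
  "pebbling_number G =
     (LEAST k. \<forall>r\<in>pverts G. \<forall>c. config_size G c = k \<longrightarrow> solvable G r c)"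

definition class_0 :: "'a pair_pre_digraph \<Rightarrow> bool" where
  "class_0 G \<longleftrightarrow> pebbling_number G = card (pverts G)"


subsection \<open>The extremal graphs\<close>

text \<open>An undirected multigraph: named edges, each with its set of end vertices.\<close>

record ('v, 'e) multigraph =
  mverts :: "'v set"
  medges :: "'e set"
  mends :: "'e \<Rightarrow> 'v set"

definition complete_multigraph :: "'v set \<Rightarrow> ('v, 'v set) multigraph" where
  "complete_multigraph V =
     \<lparr> mverts = V, medges = {e. e \<subseteq> V \<and> card e = 2}, mends = (\<lambda>e. e) \<rparr>"

text \<open>Replace every edge \<open>e\<close> by \<open>m e\<close> parallel edges \<open>(e, 0), \<dots>, (e, m e - 1)\<close>.\<close>

definition multiply_edges ::
  "('e \<Rightarrow> nat) \<Rightarrow> ('v, 'e) multigraph \<Rightarrow> ('v, 'e \<times> nat) multigraph" where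
  "multiply_edges m M =
     \<lparr> mverts = mverts M,
       medges = {(e, i). e \<in> medges M \<and> i < m e},
       mends = (\<lambda>(e, i). mends M e) \<rparr>"

text \<open>
  Subdivide exactly once each edge whose name lies in \<open>S\<close>; the vertex subdividing \<open>e\<close> is \<open>Inr e\<close>.
  The result is a simple graph as soon as \<open>M\<close> is loopless and no two edges outside \<open>S\<close> are parallel.
\<close>

definition subdivide_edges ::
  "'e set \<Rightarrow> ('v, 'e) multigraph \<Rightarrow> ('v + 'e) pair_pre_digraph" where
  "subdivide_edges S M =
     \<lparr> pverts = Inl ` mverts M \<union> Inr ` (medges M \<inter> S),
       parcs = {(Inl x, Inl y) | x y e. e \<in> medges M - S \<and> mends M e = {x, y}}
             \<union> {(Inl x, Inr e) | x e. e \<in> medges M \<inter> S \<and> x \<in> mends M e}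
             \<union> {(Inr e, Inl x) | x e. e \<in> medges M \<inter> S \<and> x \<in> mends M e} \<rparr>"

text \<open>
  In both families the chosen vertex \<open>v\<close> is \<open>0\<close>, and \<open>{(e, i). 0 \<in> e}\<close> consists of the names of
  the edges at \<open>v\<close> after multiplication.
\<close>

definition F_graph :: "nat \<Rightarrow> nat \<Rightarrow> (nat + nat set \<times> nat) pair_pre_digraph" where
  "F_graph p q =
     subdivide_edges {(e, i). 0 \<in> e}
       (multiply_edges (\<lambda>e. if e = {0, 1} then p else if e = {0, 2} then q else 1)
         (complete_multigraph {0, 1, 2}))"

definition G_graph :: "nat \<Rightarrow> nat \<Rightarrow> nat \<Rightarrow> (nat + nat set \<times> nat) pair_pre_digraph" where
  "G_graph p q r =
     subdivide_edges {(e, i). 0 \<in> e}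
       (multiply_edges
         (\<lambda>e. if e = {0, 1} then p else if e = {0, 2} then q else if e = {0, 3} then r else 1)
         (complete_multigraph {0, 1, 2, 3}))"

text \<open>The Petersen graph as the Kneser graph of the two-element subsets of a five-element set.\<close>

definition petersen :: "nat set pair_pre_digraph" where
  "petersen =
     \<lparr> pverts = {s. s \<subseteq> {0..<5} \<and> card s = 2},
       parcs = {(s, t). s \<subseteq> {0..<5} \<and> card s = 2 \<and> t \<subseteq> {0..<5} \<and> card t = 2 \<and> s \<inter> t = {}} \<rparr>"

end

theory Submission
  imports Defs
begin

text \<open>
  Write \<open>n\<close> for the number of vertices and count arcs, that is, every edge twice; the bound becomes
  \<open>4 n \<le> card E + 10\<close>. A graph of diameter two without a cut-vertex has minimum degree at least two,
  and minimum degree four gives \<open>card E \<ge> 4 n\<close>. This leaves minimum degree two or three.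

  Let \<open>v\<close> have the minimum degree three and let \<open>H\<close> be the set of vertices that are neither \<open>v\<close> nor
  adjacent to it. Every vertex of \<open>H\<close> has a neighbour in common with \<open>v\<close> and has degree at least
  three. Adding up all degrees gives \<open>card E \<ge> 6 + 4 card H = 4 n - 10\<close>. In the case of equality,
  the vertices of \<open>H\<close> have degree three and exactly one neighbour in common with \<open>v\<close>, and the
  neighbours of \<open>v\<close> are pairwise nonadjacent (\<open>degree_three_bound\<close>). Applied to every vertex of degree
  three this makes the graph cubic, hence \<open>n = 10\<close>, with neither triangles nor 4-cycles
  (\<open>extremal_min_degree_three\<close>). Only the Petersen graph is like this (\<open>petersen_labelling\<close>).

  Let \<open>v\<close> have just two neighbours \<open>a\<close> and \<open>b\<close>. All other vertices are adjacent to \<open>a\<close> only, to \<open>b\<close> only,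
  or to both; let \<open>A\<close>, \<open>B\<close>, \<open>C\<close> be these classes. By \<open>card_E_eq\<close> the bound says that the subgraph
  induced on \<open>A \<union> B \<union> C\<close> has at least \<open>card A + card B - 1\<close> edges (one fewer if \<open>a\<close> and \<open>b\<close> are
  adjacent). If \<open>A\<close> and \<open>B\<close> are nonempty this is so because every vertex of \<open>A\<close> is within distance two
  of every vertex of \<open>B\<close> inside that subgraph, so that \<open>A \<union> B\<close> lies in one component
  (\<open>connected_cross\<close>). If \<open>A\<close> or \<open>B\<close> is empty the inequality is strict (\<open>strict_if_only_a_empty\<close>).
  In the case of equality that component is a tree on \<open>A \<union> B\<close>. A leaf of it, say in \<open>A\<close>, has its
  neighbour \<open>p\<close> in \<open>B\<close>, and all of \<open>B\<close> must be within distance one of \<open>p\<close>. Counting the edges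
  again leaves a star or a double star (\<open>leaf_structure\<close>): these are the graphs \<open>F\<^sub>p\<^sub>,\<^sub>q\<close> and \<open>G\<^sub>p\<^sub>,\<^sub>q\<^sub>,\<^sub>r\<close>.

  All isomorphisms come from one principle (\<open>digraph_iso_if_spanning_embedding\<close>): an injective
  homomorphism onto all vertices is an isomorphism if the numbers of arcs agree. So only the
  presence of the edges named in a structure has to be checked, never the absence of others.

  Finally, a graph of diameter two with a cut-vertex is not Class 0: put three pebbles on one side of
  the cut-vertex, none on the cut-vertex and on a root on the other side, and one everywhere else. These
  are \<open>n\<close> pebbles, and no pebble can ever reach the root (\<open>cut_vertex_unsolvable\<close>).
\<close>

section \<open>Counting arcs in simple graphs\<close>

locale simple_graph =
  fixes V :: "'a set" and E :: "('a \<times> 'a) set"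
  assumes finite_V: "finite V"
    and E_subset: "E \<subseteq> V \<times> V"
    and sym_E: "sym E"
    and irrefl_E: "irrefl E"
begin

definition nbrs :: "'a \<Rightarrow> 'a set" where
  "nbrs u = E `` {u}"

definition arcs_between :: "'a set \<Rightarrow> 'a set \<Rightarrow> nat" where
  "arcs_between X Y = card (E \<inter> X \<times> Y)"

text \<open>
  Connectedness of the subgraph induced on \<open>S\<close> is phrased through cuts rather than paths, because
  the edge count grows a vertex set one vertex at a time.
\<close>

definition connected_on :: "'a set \<Rightarrow> bool" where
  "connected_on S \<longleftrightarrow> (\<forall>T\<subseteq>S. T \<noteq> {} \<longrightarrow> T \<noteq> S \<longrightarrow> (\<exists>x\<in>T. \<exists>y\<in>S - T. (x, y) \<in> E))"

lemma in_nbrs [simp]: "w \<in> nbrs u \<longleftrightarrow> (u, w) \<in> E"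
  by (simp add: nbrs_def)

lemma adj_sym: "(u, w) \<in> E \<Longrightarrow> (w, u) \<in> E"
  using sym_E by (rule symD)

lemma adj_commute: "(u, w) \<in> E \<longleftrightarrow> (w, u) \<in> E"
  using adj_sym by blast

lemma not_adj_self [simp]: "(u, u) \<notin> E"
  using irrefl_E by (simp add: irrefl_def)

lemma adj_neq: "(u, w) \<in> E \<Longrightarrow> u \<noteq> w"
  by auto

lemma adj_in_V: "(u, w) \<in> E \<Longrightarrow> u \<in> V" "(u, w) \<in> E \<Longrightarrow> w \<in> V"
  using E_subset by auto

lemma finite_E [simp]: "finite E"
  using E_subset finite_V by (meson finite_SigmaI finite_subset)

lemma nbrs_subset: "nbrs u \<subseteq> V"
  using adj_in_V by auto

lemma finite_nbrs [simp]: "finite (nbrs u)"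
  using nbrs_subset finite_V by (rule finite_subset)

lemma card_nbrs_Int_ge_1: "(x, y) \<in> E \<Longrightarrow> y \<in> Y \<Longrightarrow> 1 \<le> card (nbrs x \<inter> Y)"
  by (auto simp: Suc_le_eq card_gt_0_iff)

lemma arcs_between_eq_sum:
  assumes "finite X"
  shows "arcs_between X Y = (\<Sum>x\<in>X. card (nbrs x \<inter> Y))"
proof -
  have "E \<inter> X \<times> Y = (SIGMA x:X. nbrs x \<inter> Y)"
    by auto
  then show ?thesis
    using assms by (simp add: arcs_between_def)
qed

lemma arcs_between_commute: "arcs_between X Y = arcs_between Y X"
proof -
  have "bij_betw prod.swap (E \<inter> X \<times> Y) (E \<inter> Y \<times> X)"
    by (rule bij_betwI[where g = prod.swap]) (auto intro: adj_sym)
  then show ?thesis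
    by (simp add: arcs_between_def bij_betw_same_card)
qed

lemma arcs_between_mono:
  "X \<subseteq> X' \<Longrightarrow> Y \<subseteq> Y' \<Longrightarrow> arcs_between X Y \<le> arcs_between X' Y'"
  unfolding arcs_between_def by (rule card_mono) auto

lemma arcs_between_Un_left:
  assumes "X \<inter> X' = {}"
  shows "arcs_between (X \<union> X') Y = arcs_between X Y + arcs_between X' Y"
proof -
  have "E \<inter> (X \<union> X') \<times> Y = (E \<inter> X \<times> Y) \<union> (E \<inter> X' \<times> Y)"
    by auto
  moreover have "(E \<inter> X \<times> Y) \<inter> (E \<inter> X' \<times> Y) = {}"
    using assms by auto
  ultimately show ?thesis
    by (simp add: arcs_between_def card_Un_disjoint)
qed

lemma arcs_between_Un_right:
  assumes "Y \<inter> Y' = {}"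
  shows "arcs_between X (Y \<union> Y') = arcs_between X Y + arcs_between X Y'"
  using arcs_between_Un_left[OF assms] by (metis arcs_between_commute)

lemma arcs_between_Un_square:
  assumes "X \<inter> Y = {}"
  shows "arcs_between (X \<union> Y) (X \<union> Y) = arcs_between X X + 2 * arcs_between X Y + arcs_between Y Y"
  using assms arcs_between_commute[of X Y]
  by (simp add: arcs_between_Un_left arcs_between_Un_right)

lemma arcs_between_V: "arcs_between V V = card E"
  using E_subset by (simp add: arcs_between_def Int_absorb2)

lemma arcs_between_singleton: "arcs_between {x} Y = card (nbrs x \<inter> Y)"
  by (simp add: arcs_between_eq_sum)

lemma arcs_between_eq_0: "arcs_between X Y = 0 \<longleftrightarrow> (\<forall>x\<in>X. \<forall>y\<in>Y. (x, y) \<notin> E)"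
  unfolding arcs_between_def by auto

lemma sum_degrees: "(\<Sum>u\<in>V. card (nbrs u)) = card E"
proof -
  have "(\<Sum>u\<in>V. card (nbrs u)) = (\<Sum>u\<in>V. card (nbrs u \<inter> V))"
    using nbrs_subset by (intro sum.cong) (auto simp: Int_absorb2)
  then show ?thesis
    using arcs_between_eq_sum[OF finite_V, of V] arcs_between_V by simp
qed

text \<open>
  Starting from a single vertex, connectedness always supplies an arc out of the set reached so
  far, and its end vertex contributes at least one new edge. This is the bound
  \<open>card S - 1\<close> for the edges of a connected graph.
\<close>

lemma connected_on_arcs_bound:
  assumes S: "S \<subseteq> V" and ne: "S \<noteq> {}" and conn: "connected_on S"
  shows "2 * card S \<le> arcs_between S S + 2"
proof -
  have finS: "finite S"
    using S finite_V by (rule finite_subset)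
  have "\<exists>T\<subseteq>S. card T = k \<and> 2 * k \<le> arcs_between T T + 2" if "1 \<le> k" "k \<le> card S" for k
    using that
  proof (induction k rule: dec_induct)
    case base
    from ne obtain s where "s \<in> S" by auto
    then show ?case
      by (intro exI[of _ "{s}"]) auto
  next
    case (step k)
    then obtain T where T: "T \<subseteq> S" "card T = k" "2 * k \<le> arcs_between T T + 2"
      by auto
    then have "T \<noteq> {}" "T \<noteq> S" "finite T"
      using step finS finite_subset by auto
    then obtain x y where xy: "x \<in> T" "y \<in> S" "y \<notin> T" "(x, y) \<in> E"
      using conn T(1) unfolding connected_on_def by blast
    have "1 \<le> card (nbrs y \<inter> T)"
      using xy adj_sym card_nbrs_Int_ge_1 by blast
    then have "arcs_between T T + 2 \<le> arcs_between ({y} \<union> T) ({y} \<union> T)"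
      using arcs_between_Un_square[of "{y}" T] xy(3) by (simp add: arcs_between_singleton)
    then have "2 * Suc k \<le> arcs_between ({y} \<union> T) ({y} \<union> T) + 2"
      using T(3) by simp
    then show ?case
      using T xy \<open>finite T\<close> by (intro exI[of _ "{y} \<union> T"]) auto
  qed
  from this[of "card S"] ne finS obtain T where "T \<subseteq> S" "card T = card S"
    "2 * card S \<le> arcs_between T T + 2"
    by (metis One_nat_def Suc_leI card_gt_0_iff order_refl)
  then show ?thesis
    using card_subset_eq[OF finS] by auto
qed

text \<open>
  The shape of \<open>F\<^sub>p\<^sub>,\<^sub>q\<close> (\<open>k = 2\<close>) and \<open>G\<^sub>p\<^sub>,\<^sub>q\<^sub>,\<^sub>r\<close> (\<open>k = 3\<close>) inside a graph: a hub \<open>w 0\<close>, a clique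
  \<open>w 1, \<dots>, w k\<close>, and nonempty classes \<open>P j\<close> of vertices that subdivide the parallel edges from the hub
  to \<open>w j\<close>. Further edges are not excluded; the arc count does that.
\<close>

definition hub_structure :: "nat \<Rightarrow> (nat \<Rightarrow> 'a) \<Rightarrow> (nat \<Rightarrow> 'a set) \<Rightarrow> bool" where
  "hub_structure k w P \<longleftrightarrow>
     inj_on w {0..k} \<and> V = w ` {0..k} \<union> (\<Union>j\<in>{1..k}. P j) \<and>
     (\<forall>j\<in>{1..k}. P j \<noteq> {} \<and> P j \<inter> w ` {0..k} = {}) \<and>
     disjoint_family_on P {1..k} \<and>
     (\<forall>i\<in>{1..k}. \<forall>j\<in>{1..k}. i \<noteq> j \<longrightarrow> (w i, w j) \<in> E) \<and>
     (\<forall>j\<in>{1..k}. \<forall>x\<in>P j. (w 0, x) \<in> E \<and> (w j, x) \<in> E)"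

text \<open>
  A vertex \<open>v\<close>, its neighbours \<open>x1\<close>, \<open>x2\<close>, \<open>x3\<close>, their further neighbours, and the hexagon
  \<open>a, b, c, a', b', c'\<close> formed by the latter. Opposite vertices of the hexagon hang on the same \<open>xi\<close>.
\<close>

definition petersen_structure :: bool where
  "petersen_structure \<longleftrightarrow> card V = 10 \<and> (\<exists>v x1 x2 x3 a a' b b' c c'.
     V = {v, x1, x2, x3, a, a', b, b', c, c'} \<and>
     {(v, x1), (v, x2), (v, x3), (x1, a), (x1, a'), (x2, b), (x2, b'), (x3, c), (x3, c'),
      (a, b), (b, c), (c, a'), (a', b'), (b', c'), (c', a)} \<subseteq> E)"

end

section \<open>Biconnected graphs of diameter two\<close>

locale biconnected_diameter_two = simple_graph +
  assumes card_V: "3 \<le> card V"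
    and common_nbr: "u \<in> V \<Longrightarrow> w \<in> V \<Longrightarrow> u \<noteq> w \<Longrightarrow> (u, w) \<notin> E \<Longrightarrow> \<exists>x. (u, x) \<in> E \<and> (x, w) \<in> E"
    and connected_minus: "v \<in> V \<Longrightarrow> connected_on (V - {v})"
begin

text \<open>
  A vertex with at most one neighbour \<open>x\<close> would be isolated once \<open>x\<close> is removed.
\<close>

lemma degree_ge_2:
  assumes v: "v \<in> V"
  shows "2 \<le> card (nbrs v)"
proof (rule ccontr)
  assume "\<not> 2 \<le> card (nbrs v)"
  then have le: "card (nbrs v) \<le> 1" by simp
  obtain x where x: "x \<in> V" "x \<noteq> v" "nbrs v \<subseteq> {x}"
  proof (cases "nbrs v = {}")
    case True
    have "V \<noteq> {v}" using card_V by auto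
    then show ?thesis using True v that by blast
  next
    case False
    then obtain x where "nbrs v = {x}"
      using le by (metis card_1_singletonE card_gt_0_iff finite_nbrs le_antisym less_eq_Suc_le One_nat_def)
    then show ?thesis using that[of x] adj_in_V by (metis adj_neq in_nbrs singletonI subset_refl)
  qed
  have "V \<noteq> {v, x}" using card_V x by auto
  then have "{v} \<noteq> V - {x}" using v x by auto
  moreover have "{v} \<subseteq> V - {x}" using v x by auto
  ultimately obtain y where "y \<in> V - {x} - {v}" "(v, y) \<in> E"
    using connected_minus[OF x(1)] unfolding connected_on_def by blast
  then show False using x by auto
qed

text \<open>
  The vertex \<open>b\<close> lies on \<open>card V - 1\<close> edges, and the connected graph without \<open>b\<close> has at least
  \<open>card V - 2\<close>.
\<close>

lemma dominating_vertex_bound: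
  assumes b: "b \<in> V" and dom: "\<And>u. u \<in> V \<Longrightarrow> u \<noteq> b \<Longrightarrow> (b, u) \<in> E"
  shows "4 * card V \<le> card E + 6"
proof -
  have N: "nbrs b \<inter> (V - {b}) = V - {b}"
    using dom by auto
  have c: "card (V - {b}) = card V - 1"
    using b finite_V by simp
  have "V - {b} \<noteq> {}"
    using c card_V by (metis One_nat_def card.empty diff_is_0_eq not_less_eq_eq numeral_3_eq_3 le_SucI)
  then have "2 * (card V - 1) \<le> arcs_between (V - {b}) (V - {b}) + 2"
    using connected_on_arcs_bound[OF _ _ connected_minus[OF b]] c by auto
  moreover have "card E = arcs_between {b} {b} + 2 * arcs_between {b} (V - {b})
      + arcs_between (V - {b}) (V - {b})"
    using arcs_between_Un_square[of "{b}" "V - {b}"] b arcs_between_V by (simp add: insert_absorb)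
  ultimately show ?thesis
    using N c card_V by (simp add: arcs_between_singleton)
qed

section \<open>Minimum degree three\<close>

text \<open>
  The degree sum splits over \<open>v\<close>, its neighbours, and \<open>H\<close>. The neighbours of \<open>v\<close> send three arcs to
  \<open>v\<close> and, by diameter two, at least one to each vertex of \<open>H\<close>; the vertices of \<open>H\<close> have degree at
  least three.
\<close>

lemma degree_three_bound:
  assumes min3: "\<And>u. u \<in> V \<Longrightarrow> 3 \<le> card (nbrs u)" and v: "v \<in> V" "card (nbrs v) = 3"
  defines "H \<equiv> V - {v} - nbrs v"
  shows "4 * card V \<le> card E + 10"
    and "4 * card V = card E + 10 \<Longrightarrow>
      arcs_between (nbrs v) (nbrs v) = 0 \<and> (\<forall>h\<in>H. card (nbrs h) = 3 \<and> card (nbrs h \<inter> nbrs v) = 1)"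
proof -
  let ?N = "nbrs v"
  have finH: "finite H" using finite_V by (simp add: H_def)
  have V_eq: "V = {v} \<union> ?N \<union> H" using v nbrs_subset by (auto simp: H_def)
  have disj: "{v} \<inter> ?N = {}" "({v} \<union> ?N) \<inter> H = {}" "?N \<inter> H = {}" by (auto simp: H_def)
  have "card ({v} \<union> ?N) = 4" using v by (simp add: card_Un_disjoint)
  then have card_H: "card V = card H + 4"
    using card_Un_disjoint[OF _ finH disj(2)] V_eq by simp
  have AV: "arcs_between X V = (\<Sum>x\<in>X. card (nbrs x))" if "finite X" for X
    using nbrs_subset that by (auto simp: arcs_between_eq_sum Int_absorb2 intro!: sum.cong)
  have "arcs_between V V = arcs_between {v} V + arcs_between ?N V + arcs_between H V"
    by (subst V_eq) (simp only: arcs_between_Un_left[OF disj(2)] arcs_between_Un_left[OF disj(1)])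
  moreover have "arcs_between {v} V = 3"
    using AV v by simp
  moreover have "arcs_between ?N V = arcs_between ?N {v} + arcs_between ?N ?N + arcs_between ?N H"
    by (subst V_eq) (simp only: arcs_between_Un_right[OF disj(2)] arcs_between_Un_right[OF disj(1)])
  moreover have "arcs_between ?N {v} = 3"
    using v by (simp add: arcs_between_commute[of _ "{v}"] arcs_between_singleton)
  moreover have "arcs_between ?N H = (\<Sum>h\<in>H. card (nbrs h \<inter> ?N))"
    using finH by (simp add: arcs_between_commute[of _ H] arcs_between_eq_sum)
  ultimately have card_E: "card E = 6 + arcs_between ?N ?N + (\<Sum>h\<in>H. card (nbrs h \<inter> ?N))
      + (\<Sum>h\<in>H. card (nbrs h))"
    using AV[OF finH] arcs_between_V by simp
  have one: "1 \<le> card (nbrs h \<inter> ?N)" if "h \<in> H" for h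
  proof -
    from that have "h \<in> V" "h \<noteq> v" "(v, h) \<notin> E" by (auto simp: H_def)
    then obtain x where "(v, x) \<in> E" "(x, h) \<in> E" using common_nbr v(1) by blast
    then show ?thesis by (intro card_nbrs_Int_ge_1[of _ x]) (auto intro: adj_sym)
  qed
  have three: "3 \<le> card (nbrs h)" if "h \<in> H" for h
    using min3 that by (auto simp: H_def)
  have s1: "card H \<le> (\<Sum>h\<in>H. card (nbrs h \<inter> ?N))"
    using sum_bounded_below[of H "1::nat", OF one] by simp
  have s3: "3 * card H \<le> (\<Sum>h\<in>H. card (nbrs h))"
    using sum_bounded_below[of H 3 "\<lambda>h. card (nbrs h)"] three by (simp add: mult.commute)
  show "4 * card V \<le> card E + 10"
    using card_E s1 s3 card_H by linarith
  assume eq: "4 * card V = card E + 10"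
  have "arcs_between ?N ?N = 0" "(\<Sum>h\<in>H. card (nbrs h \<inter> ?N)) = (\<Sum>h\<in>H. 1)"
    "(\<Sum>h\<in>H. card (nbrs h)) = (\<Sum>h\<in>H. 3)"
    using card_E s1 s3 card_H eq by simp_all
  moreover have "card (nbrs h) = 3 \<and> card (nbrs h \<inter> ?N) = 1" if "h \<in> H" for h
    using sum_mono_inv[OF calculation(2)[symmetric] one that finH]
      sum_mono_inv[OF calculation(3)[symmetric] three that finH] by simp
  ultimately show "arcs_between ?N ?N = 0 \<and> (\<forall>h\<in>H. card (nbrs h) = 3 \<and> card (nbrs h \<inter> ?N) = 1)"
    by blast
qed

text \<open>
  Equality can be exploited at every vertex of degree three. This applies first to the vertices that
  are not adjacent to \<open>v\<close>. For a neighbour \<open>u\<close> of \<open>v\<close>, walk from another neighbour \<open>x\<close> of \<open>v\<close> to some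
  \<open>h \<noteq> v\<close>: then \<open>h\<close> has degree three and shares only \<open>x\<close> with \<open>v\<close>, so \<open>u\<close> is not adjacent to \<open>h\<close> and equality
  at \<open>h\<close> forces degree three on \<open>u\<close>.
\<close>

lemma extremal_min_degree_three:
  assumes min3: "\<And>u. u \<in> V \<Longrightarrow> 3 \<le> card (nbrs u)" and v: "v \<in> V" "card (nbrs v) = 3"
    and eq: "4 * card V = card E + 10"
  shows "card V = 10" and "\<And>u. u \<in> V \<Longrightarrow> card (nbrs u) = 3"
    and "\<And>u x y. (u, x) \<in> E \<Longrightarrow> (u, y) \<in> E \<Longrightarrow> (x, y) \<notin> E"
    and "\<And>u w x y. u \<noteq> w \<Longrightarrow> (u, x) \<in> E \<Longrightarrow> (u, y) \<in> E \<Longrightarrow> (w, x) \<in> E \<Longrightarrow> (w, y) \<in> E \<Longrightarrow> x = y"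
proof -
  have no_arc: "(x, y) \<notin> E" if "u \<in> V" "card (nbrs u) = 3" "(u, x) \<in> E" "(u, y) \<in> E" for u x y
    using degree_three_bound(2)[OF min3 that(1,2) eq] that(3,4) by (auto simp: arcs_between_eq_0)
  have far: "card (nbrs h) = 3 \<and> card (nbrs h \<inter> nbrs u) = 1"
    if "u \<in> V" "card (nbrs u) = 3" "h \<in> V" "h \<noteq> u" "(u, h) \<notin> E" for u h
    using degree_three_bound(2)[OF min3 that(1,2) eq] that(3-) by auto
  show cubic: "card (nbrs u) = 3" if u: "u \<in> V" for u
  proof (cases "(v, u) \<in> E")
    case False
    then show ?thesis using far[OF v u] v by blast
  next
    case True
    obtain x where x: "x \<in> nbrs v" "x \<noteq> u"
    proof -
      have "\<not> nbrs v \<subseteq> {u}" using v(2) card_mono[of "{u}" "nbrs v"] by auto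
      then show ?thesis using that by blast
    qed
    obtain h where h: "h \<in> nbrs x" "h \<noteq> v"
    proof -
      have "\<not> nbrs x \<subseteq> {v}" using min3[of x] adj_in_V(2)[of v x] x(1) card_mono[of "{v}" "nbrs x"] by auto
      then show ?thesis using that by blast
    qed
    have hV: "h \<in> V" "(x, h) \<in> E" "(h, x) \<in> E" using h adj_in_V adj_sym by auto
    have vh: "(v, h) \<notin> E" using no_arc[OF v, of x h] x hV by auto
    then have h3: "card (nbrs h) = 3" "card (nbrs h \<inter> nbrs v) = 1" using far[OF v hV(1) h(2)] by auto
    have "(h, u) \<notin> E"
    proof
      assume "(h, u) \<in> E"
      then have "{x, u} \<subseteq> nbrs h \<inter> nbrs v" using hV x True by auto
      then have "card {x, u} \<le> 1" using h3(2) by (metis card_mono finite_Int finite_nbrs)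
      then show False using x(2) by simp
    qed
    moreover have "u \<noteq> h" using True vh by auto
    ultimately show ?thesis using far[OF hV(1) h3(1) u] by blast
  qed
  have "card E = 3 * card V"
    using sum_degrees cubic by simp
  then show "card V = 10" using eq by simp
  show tri: "(x, y) \<notin> E" if "(u, x) \<in> E" "(u, y) \<in> E" for u x y
    using no_arc[OF _ cubic that] adj_in_V(1)[OF that(1)] by blast
  show "x = y" if "u \<noteq> w" "(u, x) \<in> E" "(u, y) \<in> E" "(w, x) \<in> E" "(w, y) \<in> E" for u w x y
  proof -
    have uw: "u \<in> V" "w \<in> V" using that adj_in_V by blast+
    have "(u, w) \<notin> E" using tri[of u w x] that by blast
    then have "card (nbrs w \<inter> nbrs u) = 1" using far[OF uw(1) cubic[OF uw(1)] uw(2)] that(1) by blast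
    then obtain z where "nbrs w \<inter> nbrs u = {z}" by (rule card_1_singletonE)
    moreover have "x \<in> nbrs w \<inter> nbrs u" "y \<in> nbrs w \<inter> nbrs u" using that by auto
    ultimately show ?thesis by simp
  qed
qed

text \<open>
  A cubic graph without triangles and 4-cycles on ten vertices: vertices at distance two have exactly one
  common neighbour. Choose \<open>v\<close>, its neighbours, and the two further neighbours \<open>a\<close>, \<open>a'\<close> of \<open>x1\<close>. The
  common neighbours of \<open>a\<close> and \<open>a'\<close> with \<open>x2\<close> are \<open>b\<close> and \<open>b'\<close>, those of \<open>b\<close> and \<open>b'\<close> with \<open>x3\<close> are
  \<open>c\<close> and \<open>c'\<close>. The path leading back from \<open>c\<close> to \<open>x1\<close> runs through \<open>a\<close> or \<open>a'\<close>, and \<open>a\<close> would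
  close a triangle.
\<close>

lemma petersen_labelling:
  assumes n: "card V = 10" and cubic: "\<And>u. u \<in> V \<Longrightarrow> card (nbrs u) = 3"
    and tri: "\<And>u x y. (u, x) \<in> E \<Longrightarrow> (u, y) \<in> E \<Longrightarrow> (x, y) \<notin> E"
    and uniq: "\<And>u w x y. u \<noteq> w \<Longrightarrow> (u, x) \<in> E \<Longrightarrow> (u, y) \<in> E \<Longrightarrow> (w, x) \<in> E \<Longrightarrow> (w, y) \<in> E \<Longrightarrow> x = y"
  shows petersen_structure
proof -
  have nbrs3: "\<exists>y z. nbrs u = {x, y, z} \<and> y \<noteq> z \<and> x \<noteq> y \<and> x \<noteq> z" if "(u, x) \<in> E" for u x
  proof -
    have "card (nbrs u - {x}) = 2" using cubic[OF adj_in_V(1)[OF that]] that by simp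
    then obtain y z where "nbrs u - {x} = {y, z}" "y \<noteq> z" by (auto simp: card_2_iff)
    moreover then have "nbrs u = {x, y, z}" using that by (metis in_nbrs insert_Diff)
    ultimately show ?thesis by blast
  qed
  have common: "\<exists>z. (u, z) \<in> E \<and> (w, z) \<in> E" if "u \<in> V" "w \<in> V" "u \<noteq> w" "(u, w) \<notin> E" for u w
    using common_nbr[OF that] adj_sym by blast
  obtain v where v: "v \<in> V" using n by fastforce
  then obtain x1 where "(v, x1) \<in> E"
    using cubic[OF v] by (metis card.empty ex_in_conv in_nbrs zero_neq_numeral)
  then obtain x2 x3 where Nv: "nbrs v = {x1, x2, x3}" and dx: "x1 \<noteq> x2" "x1 \<noteq> x3" "x2 \<noteq> x3"
    using nbrs3 by metis
  have vx: "(v, x1) \<in> E" "(v, x2) \<in> E" "(v, x3) \<in> E" using Nv in_nbrs by blast+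
  note xv = vx[THEN adj_sym]
  have xV: "x1 \<in> V" "x2 \<in> V" "x3 \<in> V" using vx adj_in_V by blast+
  obtain a a' where N1: "nbrs x1 = {v, a, a'}" and da: "a \<noteq> a'" "v \<noteq> a" "v \<noteq> a'"
    using nbrs3[OF xv(1)] by metis
  have xa: "(x1, a) \<in> E" "(x1, a') \<in> E" using N1 in_nbrs by blast+
  note ax = xa[THEN adj_sym]
  have aV: "a \<in> V" "a' \<in> V" using xa adj_in_V by blast+
  have v_far: "(v, z) \<notin> E" "(z, v) \<notin> E" if "(v, x) \<in> E" "(x, z) \<in> E" for x z
    using tri[OF that(1), of z] that(2) adj_sym by blast+
  have x_only: "(y, z) \<notin> E" "(z, y) \<notin> E"
    if "(x, z) \<in> E" "x \<noteq> y" "(v, x) \<in> E" "(v, y) \<in> E" "v \<noteq> z" for x y z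
  proof -
    show "(y, z) \<notin> E" using uniq[OF that(2,1) adj_sym[OF that(3)] _ adj_sym[OF that(4)]] that(5) by blast
    then show "(z, y) \<notin> E" using adj_sym by blast
  qed
  note dx' = dx[symmetric]
  note va = v_far[OF vx(1) xa(1)] v_far[OF vx(1) xa(2)]
  note a_far = x_only[OF xa(1) dx(1) vx(1,2) da(2)] x_only[OF xa(2) dx(1) vx(1,2) da(3)]
    x_only[OF xa(1) dx(2) vx(1,3) da(2)] x_only[OF xa(2) dx(2) vx(1,3) da(3)]
  have a_neq: "a \<noteq> x2" "a' \<noteq> x2" using va vx by auto
  obtain b where b: "(a, b) \<in> E" "(x2, b) \<in> E" using common[OF aV(1) xV(2) a_neq(1) a_far(2)] by blast
  obtain b' where b': "(a', b') \<in> E" "(x2, b') \<in> E" using common[OF aV(2) xV(2) a_neq(2) a_far(4)] by blast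
  have nvb: "v \<noteq> b" "v \<noteq> b'" using va b b' by auto
  have bb: "b \<noteq> b'"
  proof
    assume "b = b'"
    then have "b = x1" using uniq[OF da(1) b(1) ax(1) _ ax(2)] b' by blast
    then show False using tri[OF vx(2,1)] b by blast
  qed
  have bV: "b \<in> V" "b' \<in> V" using b b' adj_in_V by blast+
  note vb = v_far[OF vx(2) b(2)] v_far[OF vx(2) b'(2)]
  note b_far = x_only[OF b(2) dx'(1) vx(2,1) nvb(1)] x_only[OF b'(2) dx'(1) vx(2,1) nvb(2)]
    x_only[OF b(2) dx(3) vx(2,3) nvb(1)] x_only[OF b'(2) dx(3) vx(2,3) nvb(2)]
  have b_neq: "b \<noteq> x3" "b' \<noteq> x3" using vb vx by auto
  obtain c where c: "(b, c) \<in> E" "(x3, c) \<in> E" using common[OF bV(1) xV(3) b_neq(1) b_far(6)] by blast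
  obtain c' where c': "(b', c') \<in> E" "(x3, c') \<in> E" using common[OF bV(2) xV(3) b_neq(2) b_far(8)] by blast
  have nvc: "v \<noteq> c" "v \<noteq> c'" using vb c c' by auto
  have cc: "c \<noteq> c'"
  proof
    assume "c = c'"
    then have "c = x2" using uniq[OF bb c(1) adj_sym[OF b(2)] _ adj_sym[OF b'(2)]] c' by blast
    then show False using tri[OF vx(3,2)] c by blast
  qed
  have cV: "c \<in> V" "c' \<in> V" using c c' adj_in_V by blast+
  note vc = v_far[OF vx(3) c(2)] v_far[OF vx(3) c'(2)]
  note c_far = x_only[OF c(2) dx'(2) vx(3,1) nvc(1)] x_only[OF c'(2) dx'(2) vx(3,1) nvc(2)]
  have c_neq: "c \<noteq> x1" "c' \<noteq> x1" using vc vx by auto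
  have adj_a_or_a': "(z, a) \<in> E \<or> (z, a') \<in> E" if z: "z \<in> V" "z \<noteq> x1" "(z, x1) \<notin> E" "(z, v) \<notin> E" for z
  proof -
    obtain y where y: "(z, y) \<in> E" "(x1, y) \<in> E" using common[OF z(1) xV(1) z(2,3)] by blast
    then have "y \<in> {v, a, a'}" using N1 in_nbrs by blast
    then show ?thesis using y(1) z(4) by auto
  qed
  have "(c, a) \<notin> E" using tri[OF adj_sym[OF b(1)] c(1)] adj_sym by blast
  then have ca': "(c, a') \<in> E"
    using adj_a_or_a'[OF cV(1) c_neq(1) c_far(2) vc(2)] by blast
  have "(c', a') \<notin> E" using tri[OF adj_sym[OF b'(1)] c'(1)] adj_sym by blast
  then have c'a: "(c', a) \<in> E"
    using adj_a_or_a'[OF cV(2) c_neq(2) c_far(4) vc(4)] by blast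
  have "distinct [v, x1, x2, x3, a, a', b, b', c, c']"
  proof -
    have "v \<notin> {x1, x2, x3}" using vx by auto
    moreover have "{x1, x2, x3} \<inter> {a, a', b, b', c, c'} = {}"
      using va vb vc vx by auto
    moreover have "{a, a'} \<inter> {b, b', c, c'} = {}" using a_far b b' c c' by auto
    moreover have "{b, b'} \<inter> {c, c'} = {}" using b_far c c' by auto
    ultimately show ?thesis using dx da nvb bb nvc cc by auto
  qed
  then have "card {v, x1, x2, x3, a, a', b, b', c, c'} = card V"
    using n distinct_card[of "[v, x1, x2, x3, a, a', b, b', c, c']"] by simp
  then have "V = {v, x1, x2, x3, a, a', b, b', c, c'}"
    using card_subset_eq[OF finite_V, of "{v, x1, x2, x3, a, a', b, b', c, c'}"] v xV aV bV cV by auto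
  moreover have "{(v, x1), (v, x2), (v, x3), (x1, a), (x1, a'), (x2, b), (x2, b'), (x3, c), (x3, c'),
      (a, b), (b, c), (c, a'), (a', b'), (b', c'), (c', a)} \<subseteq> E"
    using vx xa b b' c c' ca' c'a by simp
  ultimately show ?thesis
    unfolding petersen_structure_def using n by (intro conjI exI)
qed

end

section \<open>A vertex of degree two\<close>

locale degree_two_vertex = biconnected_diameter_two +
  fixes v a b :: 'a
  assumes v: "v \<in> V" and nbrs_v: "nbrs v = {a, b}" and a_neq_b: "a \<noteq> b"
begin

definition rest :: "'a set" where "rest = V - {v, a, b}"
definition only_a :: "'a set" where "only_a = {x \<in> rest. (a, x) \<in> E \<and> (b, x) \<notin> E}"
definition only_b :: "'a set" where "only_b = {x \<in> rest. (b, x) \<in> E \<and> (a, x) \<notin> E}"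
definition both :: "'a set" where "both = {x \<in> rest. (a, x) \<in> E \<and> (b, x) \<in> E}"

lemma adj_v: "(v, x) \<in> E \<longleftrightarrow> x = a \<or> x = b" "(x, v) \<in> E \<longleftrightarrow> x = a \<or> x = b"
  using nbrs_v adj_commute in_nbrs by blast+

lemma v_a_b: "v \<noteq> a" "v \<noteq> b" "a \<in> V" "b \<in> V"
  using adj_v adj_in_V not_adj_self by blast+

text \<open>
  The roles of \<open>a\<close> and \<open>b\<close> are symmetric; the interpretation with the two exchanged transfers every
  result about one class to the other.
\<close>

lemma swapped: "degree_two_vertex V E v b a"
  using v nbrs_v a_neq_b by unfold_locales auto

lemma swapped_classes:
  "degree_two_vertex.rest V v b a = rest"
  "degree_two_vertex.only_a V E v b a = only_b"
  "degree_two_vertex.only_b V E v b a = only_a"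
  "degree_two_vertex.both V E v b a = both"
proof -
  interpret swap: degree_two_vertex V E v b a by (rule swapped)
  show "swap.rest = rest" unfolding swap.rest_def rest_def by auto
  then show "swap.only_a = only_b" "swap.only_b = only_a" "swap.both = both"
    unfolding swap.only_a_def swap.only_b_def swap.both_def only_a_def only_b_def both_def by auto
qed

lemma rest_eq: "rest = only_a \<union> only_b \<union> both"
proof -
  have "(a, x) \<in> E \<or> (b, x) \<in> E" if "x \<in> rest" for x
  proof -
    have "x \<in> V" "x \<noteq> v" "(v, x) \<notin> E" using that adj_v by (auto simp: rest_def)
    then show ?thesis using common_nbr[OF v, of x] adj_v by auto
  qed
  then show ?thesis by (auto simp: only_a_def only_b_def both_def)
qed

lemma disjoint_classes: "only_a \<inter> only_b = {}" "only_a \<inter> both = {}" "only_b \<inter> both = {}"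
  by (auto simp: only_a_def only_b_def both_def)

lemma finite_classes [simp]: "finite rest" "finite only_a" "finite only_b" "finite both"
  using finite_V by (auto simp: rest_def only_a_def only_b_def both_def)

lemma V_eq: "V = {v} \<union> ({a, b} \<union> rest)"
  using v v_a_b by (auto simp: rest_def)

lemma card_V_eq: "card V = card only_a + card only_b + card both + 3"
proof -
  have "card rest = card only_a + card only_b + card both"
    unfolding rest_eq using disjoint_classes by (simp add: card_Un_disjoint Int_Un_distrib2)
  moreover have "card V = card {v, a, b} + card rest"
  proof -
    have "V = {v, a, b} \<union> rest" using V_eq by blast
    moreover have "card ({v, a, b} \<union> rest) = card {v, a, b} + card rest"
      by (rule card_Un_disjoint) (auto simp: rest_def finite_V)
    ultimately show ?thesis by metis
  qed
  ultimately show ?thesis using v_a_b a_neq_b by simp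
qed

text \<open>
  The bound \<open>4 * card V \<le> card E + 10\<close> becomes a statement about the arcs inside \<open>rest\<close>.
\<close>

lemma card_E_eq:
  "card E + 10 + 2 * (card only_a + card only_b) =
     4 * card V + 2 + (if (a, b) \<in> E then 2 else 0) + arcs_between rest rest"
proof -
  have d: "{v} \<inter> ({a, b} \<union> rest) = {}" "{a, b} \<inter> rest = {}"
    using v_a_b by (auto simp: rest_def)
  have "arcs_between V V = arcs_between {v} {v} + 2 * arcs_between {v} ({a, b} \<union> rest)
      + (arcs_between {a, b} {a, b} + 2 * arcs_between {a, b} rest + arcs_between rest rest)"
    by (subst (1 2) V_eq) (simp only: arcs_between_Un_square[OF d(1)] arcs_between_Un_square[OF d(2)])
  moreover have "arcs_between {v} {v} = 0" by (simp add: arcs_between_eq_0)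
  moreover have "arcs_between {v} ({a, b} \<union> rest) = 2"
  proof -
    have "nbrs v \<inter> ({a, b} \<union> rest) = {a, b}" using nbrs_v by auto
    then show ?thesis using a_neq_b by (simp only: arcs_between_singleton) simp
  qed
  moreover have "arcs_between {a, b} {a, b} = (if (a, b) \<in> E then 2 else 0)"
  proof -
    have "nbrs a \<inter> {a, b} = (if (a, b) \<in> E then {b} else {})" by auto
    moreover have "nbrs b \<inter> {a, b} = (if (a, b) \<in> E then {a} else {})"
      using adj_commute[of a b] by auto
    ultimately show ?thesis using a_neq_b by (simp add: arcs_between_eq_sum)
  qed
  moreover have "arcs_between {a, b} rest = card only_a + card only_b + 2 * card both"
  proof -
    have "nbrs a \<inter> rest = only_a \<union> both" "nbrs b \<inter> rest = only_b \<union> both"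
      by (auto simp: only_a_def only_b_def both_def)
    then show ?thesis using a_neq_b disjoint_classes by (simp add: arcs_between_eq_sum card_Un_disjoint)
  qed
  ultimately show ?thesis using card_V_eq arcs_between_V by simp
qed

lemma adj_classes:
  "x \<in> only_a \<Longrightarrow> (a, x) \<in> E" "x \<in> only_a \<Longrightarrow> (x, a) \<in> E" "x \<in> only_b \<Longrightarrow> (b, x) \<in> E" "x \<in> only_b \<Longrightarrow> (x, b) \<in> E"
  "x \<in> both \<Longrightarrow> (a, x) \<in> E" "x \<in> both \<Longrightarrow> (x, a) \<in> E" "x \<in> both \<Longrightarrow> (b, x) \<in> E" "x \<in> both \<Longrightarrow> (x, b) \<in> E"
  by (auto simp: only_a_def only_b_def both_def intro: adj_sym)

lemma not_adj_classes:
  "x \<in> only_a \<Longrightarrow> (b, x) \<notin> E" "x \<in> only_a \<Longrightarrow> (x, b) \<notin> E" "x \<in> only_b \<Longrightarrow> (a, x) \<notin> E" "x \<in> only_b \<Longrightarrow> (x, a) \<notin> E"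
  by (auto simp: only_a_def only_b_def dest: adj_sym)

lemma rest_not_adj_v: "x \<in> rest \<Longrightarrow> (x, v) \<notin> E"
  using adj_v by (auto simp: rest_def)

lemma adj_cases: "(x, z) \<in> E \<Longrightarrow> z = v \<or> z = a \<or> z = b \<or> z \<in> rest"
  by (auto simp: rest_def dest: adj_in_V)

text \<open>
  A common neighbour of the two vertices cannot be \<open>v\<close>, \<open>a\<close> or \<open>b\<close>, since none of these is adjacent to
  both of them.
\<close>

lemma path_only_a_only_b:
  assumes x: "x \<in> only_a" and y: "y \<in> only_b" and nadj: "(x, y) \<notin> E"
  shows "\<exists>z\<in>rest. (x, z) \<in> E \<and> (z, y) \<in> E"
proof -
  have xy: "x \<in> rest" "y \<in> rest" "x \<noteq> y" using x y rest_eq disjoint_classes by auto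
  then obtain z where z: "(x, z) \<in> E" "(z, y) \<in> E"
    using common_nbr[of x y] nadj by (auto simp: rest_def)
  then have "z \<in> rest"
    using adj_cases[OF z(1)] not_adj_classes(2)[OF x] not_adj_classes(3)[OF y] rest_not_adj_v[OF xy(1)] z by blast
  then show ?thesis using z by auto
qed

text \<open>
  The vertex \<open>x\<close> is at distance two from \<open>b\<close>, and neither \<open>v\<close> nor \<open>a\<close> can be in between.
\<close>

lemma only_a_cross_nbr:
  assumes ab: "(a, b) \<notin> E" and x: "x \<in> only_a"
  shows "\<exists>z\<in>only_b \<union> both. (x, z) \<in> E"
proof -
  have xr: "x \<in> rest" using x rest_eq by auto
  then obtain z where z: "(x, z) \<in> E" "(z, b) \<in> E"
    using common_nbr[of x b] not_adj_classes(2)[OF x] v_a_b by (auto simp: rest_def)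
  then have "z \<in> rest"
    using adj_cases[OF z(1)] rest_not_adj_v[OF xr] not_adj_classes(2)[OF x] ab z by blast
  then have "z \<in> only_b \<union> both"
    using z(2) by (auto simp: only_b_def both_def intro: adj_sym)
  then show ?thesis using z by auto
qed

text \<open>
  The two one-sided classes together with those common neighbours of \<open>a\<close> and \<open>b\<close> that may be needed to
  connect them.
\<close>

definition cross :: "'a set" where
  "cross = only_a \<union> only_b \<union> {z \<in> both. \<exists>s\<in>only_a \<union> only_b. (z, s) \<in> E}"

text \<open>
  A cut without arcs cannot separate a vertex of \<open>only_a\<close> from one of \<open>only_b\<close>, because these are
  within distance two inside \<open>cross\<close>. As both classes are nonempty, they lie on one side together, and every further vertex
  of \<open>cross\<close> has a neighbour there.
\<close>

lemma connected_cross: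
  assumes "only_a \<noteq> {}" "only_b \<noteq> {}"
  shows "connected_on cross"
  unfolding connected_on_def
proof (intro allI impI, rule ccontr)
  fix T assume T: "T \<subseteq> cross" "T \<noteq> {}" "T \<noteq> cross"
    and "\<not> (\<exists>x\<in>T. \<exists>y\<in>cross - T. (x, y) \<in> E)"
  then have no: "\<And>x y. x \<in> T \<Longrightarrow> y \<in> cross \<Longrightarrow> (x, y) \<in> E \<Longrightarrow> y \<in> T" by blast
  then have step: "\<And>x y. x \<in> cross \<Longrightarrow> y \<in> cross \<Longrightarrow> (x, y) \<in> E \<Longrightarrow> x \<in> T \<longleftrightarrow> y \<in> T"
    using adj_sym by blast
  have same: "x \<in> T \<longleftrightarrow> y \<in> T" if xy: "x \<in> only_a" "y \<in> only_b" for x y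
  proof -
    have c: "x \<in> cross" "y \<in> cross" using xy by (auto simp: cross_def)
    show ?thesis
    proof (cases "(x, y) \<in> E")
      case True
      then show ?thesis using step c by blast
    next
      case False
      then obtain z where z: "z \<in> rest" "(x, z) \<in> E" "(z, y) \<in> E"
        using path_only_a_only_b xy by blast
      then have "z \<in> cross" using xy rest_eq by (auto simp: cross_def)
      then show ?thesis using step c z by blast
    qed
  qed
  have near: "\<exists>s\<in>only_a \<union> only_b. s \<in> T \<longleftrightarrow> z \<in> T" if z: "z \<in> cross" for z
  proof (cases "z \<in> only_a \<union> only_b")
    case True
    then show ?thesis by blast
  next
    case False
    then obtain s where s: "s \<in> only_a \<union> only_b" "(z, s) \<in> E" using z by (auto simp: cross_def)
    then have "s \<in> cross" by (auto simp: cross_def)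
    then show ?thesis using s step[OF z] by blast
  qed
  obtain x y where xy: "x \<in> only_a" "y \<in> only_b" using assms by auto
  have all: "s \<in> T \<longleftrightarrow> x \<in> T" if "s \<in> only_a \<union> only_b" for s
    using that same[OF _ xy(2)] same[OF xy(1)] xy by blast
  obtain t u where "t \<in> T" "u \<in> cross" "u \<notin> T" using T by auto
  then show False
    using near[of t] near[of u] all T(1) by blast
qed

lemma cross_arcs_bound:
  assumes "only_a \<noteq> {}" "only_b \<noteq> {}"
  shows "2 * card cross \<le> arcs_between rest rest + 2"
proof -
  have "cross \<subseteq> rest" using rest_eq by (auto simp: cross_def)
  then have "2 * card cross \<le> arcs_between cross cross + 2"
    using assms connected_on_arcs_bound[OF _ _ connected_cross[OF assms]]
    by (auto simp: rest_def cross_def)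
  also have "\<dots> \<le> arcs_between rest rest + 2"
    using arcs_between_mono[OF \<open>cross \<subseteq> rest\<close> \<open>cross \<subseteq> rest\<close>] by simp
  finally show ?thesis .
qed

text \<open>
  If \<open>a\<close> and \<open>b\<close> are adjacent, then \<open>b\<close> dominates the graph. Otherwise each vertex of \<open>only_b\<close> needs
  an edge of its own to \<open>both\<close> in order to be within distance two of \<open>a\<close>.
\<close>

lemma strict_if_only_a_empty:
  assumes "only_a = {}"
  shows "4 * card V < card E + 10"
proof (cases "(a, b) \<in> E")
  case True
  then have ba: "(b, a) \<in> E" by (rule adj_sym)
  have bv: "(b, v) \<in> E" by (simp add: adj_v)
  have "(b, u) \<in> E" if u: "u \<in> V" "u \<noteq> b" for u
  proof (cases "u \<in> rest")
    case True
    then have "u \<in> only_b \<or> u \<in> both" using rest_eq assms by blast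
    then show ?thesis using adj_classes(3,7) by blast
  next
    case False
    then have "u = v \<or> u = a" using u by (simp add: rest_def)
    then show ?thesis using ba bv by blast
  qed
  then have "4 * card V \<le> card E + 6"
    using dominating_vertex_bound[OF v_a_b(4)] by blast
  then show ?thesis by simp
next
  case False
  interpret swap: degree_two_vertex V E v b a by (rule swapped)
  have "\<exists>z\<in>both. (y, z) \<in> E" if "y \<in> only_b" for y
  proof -
    have "(b, a) \<notin> E" using False adj_sym by blast
    then show ?thesis
      using swap.only_a_cross_nbr[of y] that assms by (simp add: swapped_classes)
  qed
  then have "1 \<le> card (nbrs y \<inter> both)" if "y \<in> only_b" for y
    using that card_nbrs_Int_ge_1 by blast
  then have "card only_b \<le> arcs_between only_b both"
    using sum_bounded_below[of only_b 1 "\<lambda>y. card (nbrs y \<inter> both)"] by (simp add: arcs_between_eq_sum)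
  moreover have "arcs_between rest rest = arcs_between only_b only_b + 2 * arcs_between only_b both
      + arcs_between both both"
    unfolding rest_eq assms using arcs_between_Un_square[OF disjoint_classes(3)] by simp
  ultimately show ?thesis
    using card_E_eq assms by simp
qed

text \<open>
  The leaf \<open>l\<close> has a single neighbour \<open>p\<close> in \<open>rest\<close>, so all of \<open>only_b\<close> is \<open>p\<close> or adjacent to \<open>p\<close>.
  The \<open>card only_b - 1\<close> edges at \<open>p\<close> within \<open>only_b\<close> and one edge from each vertex of \<open>only_a\<close> to \<open>only_b\<close> already exhaust the
  edges available. If \<open>only_b\<close> had two vertices \<open>y\<close>, \<open>y'\<close> besides \<open>p\<close>, a vertex of \<open>only_a\<close>
  adjacent to \<open>y\<close> could not come within distance two of \<open>y'\<close>. The hub is \<open>a\<close>, and its partners are \<open>b\<close>,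
  reached through \<open>v\<close> and \<open>both\<close>, and the one or two vertices of \<open>only_b\<close>, reached through \<open>only_a\<close>.
\<close>

lemma leaf_structure:
  assumes ne: "only_a \<noteq> {}" "only_b \<noteq> {}" and ab: "(a, b) \<notin> E"
    and noC: "\<And>z s. z \<in> both \<Longrightarrow> s \<in> only_a \<union> only_b \<Longrightarrow> (s, z) \<notin> E"
    and count: "arcs_between rest rest + 2 \<le> 2 * (card only_a + card only_b)"
    and l: "l \<in> only_a" "card (nbrs l \<inter> rest) \<le> 1"
  shows "\<exists>w P. hub_structure 2 w P \<or> hub_structure 3 w P"
proof -
  interpret swap: degree_two_vertex V E v b a by (rule swapped)
  have nbr_b: "\<exists>y\<in>only_b. (x, y) \<in> E" if "x \<in> only_a" for x
    using only_a_cross_nbr[OF ab that] noC that by blast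
  have nbr_a: "\<exists>x\<in>only_a. (x, y) \<in> E" if y: "y \<in> only_b" for y
  proof -
    have "(b, a) \<notin> E" using ab adj_sym by blast
    then obtain z where z: "z \<in> only_a \<union> both" "(y, z) \<in> E"
      using swap.only_a_cross_nbr[of y] y by (auto simp: swapped_classes)
    then show ?thesis using noC y adj_sym by blast
  qed
  obtain p where p: "p \<in> only_b" "(l, p) \<in> E"
    using nbr_b l by blast
  have l_only: "z = p" if "z \<in> rest" "(l, z) \<in> E" for z
  proof -
    have "{z, p} \<subseteq> nbrs l \<inter> rest" using that p rest_eq by auto
    then have "card {z, p} \<le> 1" using l(2) by (meson card_mono finite_Int finite_nbrs le_trans)
    then show ?thesis by (auto simp: card_insert_if split: if_splits)
  qed
  have B_nbr: "(p, y) \<in> E" if "y \<in> only_b" "y \<noteq> p" for y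
    using path_only_a_only_b[OF l(1) that(1)] l_only that rest_eq by blast
  let ?B1 = "only_b - {p}"
  have B_eq: "only_b = {p} \<union> ?B1" "{p} \<inter> ?B1 = {}" using p by auto
  have "nbrs p \<inter> ?B1 = ?B1" using B_nbr by auto
  then have pB1: "arcs_between {p} ?B1 = card only_b - 1"
    using p by (simp add: arcs_between_singleton)
  have card_b: "1 \<le> card only_b" using ne by (simp add: Suc_leI card_gt_0_iff)
  have BB: "arcs_between only_b only_b + 2 = 2 * card only_b + arcs_between ?B1 ?B1"
    using arcs_between_Un_square[OF B_eq(2)] B_eq(1) pB1 card_b by (simp add: arcs_between_singleton)
  have one: "1 \<le> card (nbrs x \<inter> only_b)" if "x \<in> only_a" for x
    using nbr_b[OF that] card_nbrs_Int_ge_1 by blast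
  have AB: "arcs_between only_a only_b = (\<Sum>x\<in>only_a. card (nbrs x \<inter> only_b))"
    by (simp add: arcs_between_eq_sum)
  have AB_ge: "card only_a \<le> arcs_between only_a only_b"
    using sum_bounded_below[of only_a 1 "\<lambda>x. card (nbrs x \<inter> only_b)"] one AB by simp
  have "arcs_between (only_a \<union> only_b) (only_a \<union> only_b) \<le> arcs_between rest rest"
    using rest_eq by (intro arcs_between_mono) auto
  then have eqs: "arcs_between only_a only_b = card only_a" "arcs_between only_a only_a = 0"
    "arcs_between ?B1 ?B1 = 0"
    using count arcs_between_Un_square[OF disjoint_classes(1)] BB AB_ge by simp_all
  have "(\<Sum>x\<in>only_a. 1) = (\<Sum>x\<in>only_a. card (nbrs x \<inter> only_b))"
    using eqs(1) AB by simp
  then have card1: "card (nbrs x \<inter> only_b) = 1" if "x \<in> only_a" for x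
    using sum_mono_inv[of "\<lambda>_. 1" only_a "\<lambda>x. card (nbrs x \<inter> only_b)" x] one that by simp
  have unique: "y = y'" if "x \<in> only_a" "y \<in> only_b" "y' \<in> only_b" "(x, y) \<in> E" "(x, y') \<in> E" for x y y'
  proof -
    have "y \<in> nbrs x \<inter> only_b" "y' \<in> nbrs x \<inter> only_b" using that by auto
    then show ?thesis using card1[OF that(1)] by (metis card_1_singletonE singletonD)
  qed
  \<comment> \<open>At most one vertex of \<open>only_b\<close> besides \<open>p\<close>: otherwise \<open>x\<close> below would be too far from \<open>y'\<close>.\<close>
  have B1_eq: "y = y'" if y: "y \<in> ?B1" "y' \<in> ?B1" for y y'
  proof (rule ccontr)
    assume neq: "y \<noteq> y'"
    obtain x where x: "x \<in> only_a" "(x, y) \<in> E" using nbr_a y by blast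
    then have "(x, y') \<notin> E" using unique[of x y y'] y neq by auto
    then obtain z where z: "z \<in> rest" "(x, z) \<in> E" "(z, y') \<in> E"
      using path_only_a_only_b[OF x(1)] y by blast
    moreover have "z \<notin> only_a" using z x eqs(2) by (auto simp: arcs_between_eq_0)
    moreover have "z \<notin> both" using z x noC by auto
    ultimately have "z \<in> only_b" using rest_eq by auto
    then have "z = y" using unique[of x z y] x y z by auto
    then show False using z y eqs(3) by (auto simp: arcs_between_eq_0)
  qed
  have diff: "v \<notin> rest" "a \<notin> rest" "b \<notin> rest" by (auto simp: rest_def)
  have sub: "only_a \<subseteq> rest" "only_b \<subseteq> rest" "both \<subseteq> rest" using rest_eq by auto
  show ?thesis
  proof (cases "?B1 = {}")
    case True
    then have B: "only_b = {p}" using p by auto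
    have Bp: "(p, x) \<in> E" if x: "x \<in> only_a" for x
      using nbr_b[OF x] B adj_commute[of x p] by simp
    \<comment> \<open>Indices start at 0 for the hub; the entry \<open>P 0\<close> is a dummy.\<close>
    define w where "w = nth [a, b, p]"
    define P where "P = nth [{}, insert v both, only_a]"
    have ixs: "{0..2} = {0, 1, 2::nat}" "{1..2} = {1, 2::nat}" by auto
    have wP: "w 0 = a" "w 1 = b" "w 2 = p"
      "P 1 = insert v both" "P 2 = only_a" "w (Suc 0) = b" "P (Suc 0) = insert v both"
      by (simp_all add: w_def P_def)
    have "hub_structure 2 w P"
      unfolding hub_structure_def ixs
    proof (intro conjI)
      show "inj_on w {0, 1, 2}" using wP a_neq_b p sub diff by auto
      show "V = w ` {0, 1, 2} \<union> (\<Union>j\<in>{1, 2}. P j)"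
        using V_eq rest_eq B wP by auto
      show "\<forall>j\<in>{1, 2}. P j \<noteq> {} \<and> P j \<inter> w ` {0, 1, 2} = {}"
        using wP ne sub diff v_a_b p disjoint_classes B by auto
      show "disjoint_family_on P {1, 2}"
        using wP disjoint_classes sub diff by (auto simp: disjoint_family_on_def)
      show "\<forall>i\<in>{1, 2}. \<forall>j\<in>{1, 2}. i \<noteq> j \<longrightarrow> (w i, w j) \<in> E"
        using wP adj_classes(3,4)[OF p(1)] by auto
      show "\<forall>j\<in>{1, 2}. \<forall>x\<in>P j. (w 0, x) \<in> E \<and> (w j, x) \<in> E"
        using wP adj_classes adj_v Bp by auto
    qed
    then show ?thesis by blast
  next
    case False
    then obtain z where B1: "?B1 = {z}" using B1_eq by blast
    then have B: "only_b = {p, z}" and pz: "p \<noteq> z" and zB: "z \<in> only_b" using p by auto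
    have pz_adj: "(p, z) \<in> E" using B_nbr[OF zB] pz by auto
    define w where "w = nth [a, b, p, z]"
    define P where "P = nth [{}, insert v both, nbrs p \<inter> only_a, nbrs z \<inter> only_a]"
    have ixs: "{0..3} = {0, 1, 2, 3::nat}" "{1..3} = {1, 2, 3::nat}" by auto
    have wP: "w 0 = a" "w 1 = b" "w 2 = p" "w 3 = z"
      "P 1 = insert v both" "P 2 = nbrs p \<inter> only_a" "P 3 = nbrs z \<inter> only_a"
      "w (Suc 0) = b" "P (Suc 0) = insert v both"
      by (simp_all add: w_def P_def numeral_3_eq_3)
    have A_eq: "only_a = (nbrs p \<inter> only_a) \<union> (nbrs z \<inter> only_a)"
    proof -
      have "(p, x) \<in> E \<or> (z, x) \<in> E" if "x \<in> only_a" for x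
        using nbr_b[OF that] adj_commute[of x] unfolding B by simp
      then show ?thesis by (intro set_eqI) (simp, blast)
    qed
    have A_dis: "(nbrs p \<inter> only_a) \<inter> (nbrs z \<inter> only_a) = {}"
      using unique[OF _ p(1) zB] pz adj_sym unfolding disjoint_iff Int_iff in_nbrs by blast
    have A_ne: "nbrs p \<inter> only_a \<noteq> {}" "nbrs z \<inter> only_a \<noteq> {}"
      using nbr_a[OF p(1)] nbr_a[OF zB] adj_sym unfolding ex_in_conv[symmetric] Int_iff in_nbrs by blast+
    have "hub_structure 3 w P"
      unfolding hub_structure_def ixs
    proof (intro conjI)
      show "inj_on w {0, 1, 2, 3}" using wP a_neq_b p zB pz sub diff by auto
      show "V = w ` {0, 1, 2, 3} \<union> (\<Union>j\<in>{1, 2, 3}. P j)"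
      proof -
        have "V = {a, b, p, z} \<union> (insert v both \<union> only_a)"
          by (subst V_eq) (unfold rest_eq B, blast)
        also have "\<dots> = {a, b, p, z} \<union> (insert v both \<union> (nbrs p \<inter> only_a \<union> nbrs z \<inter> only_a))"
          using A_eq by simp
        finally show ?thesis by (simp add: wP Un_assoc)
      qed
      show "\<forall>j\<in>{1, 2, 3}. P j \<noteq> {} \<and> P j \<inter> w ` {0, 1, 2, 3} = {}"
      proof -
        have "insert v both \<inter> {a, b, p, z} = {}"
          using v_a_b diff sub p(1) zB disjoint_classes(3) by blast
        moreover have "only_a \<inter> {a, b, p, z} = {}"
          using diff sub p(1) zB disjoint_classes(1) by blast
        ultimately show ?thesis
          using A_ne by (simp add: wP)
      qed
      show "disjoint_family_on P {1, 2, 3}"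
        using wP disjoint_classes sub diff A_dis by (auto simp: disjoint_family_on_def)
      show "\<forall>i\<in>{1, 2, 3}. \<forall>j\<in>{1, 2, 3}. i \<noteq> j \<longrightarrow> (w i, w j) \<in> E"
        using wP adj_classes(3,4)[OF p(1)] adj_classes(3,4)[OF zB] pz_adj adj_sym[OF pz_adj] by auto
      show "\<forall>j\<in>{1, 2, 3}. \<forall>x\<in>P j. (w 0, x) \<in> E \<and> (w j, x) \<in> E"
        using wP adj_classes adj_v by auto
    qed
    then show ?thesis by blast
  qed
qed

text \<open>
  Equality forces \<open>card cross = card only_a + card only_b\<close>, so no vertex of \<open>both\<close> has a neighbour in
  the other classes. A vertex with at most one neighbour in \<open>rest\<close> then exists, because two neighbours
  for every vertex of \<open>only_a\<close> and \<open>only_b\<close> would be too many arcs.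
\<close>

lemma degree_two_bound:
  shows "4 * card V \<le> card E + 10"
    and "4 * card V = card E + 10 \<Longrightarrow> \<exists>w P. hub_structure 2 w P \<or> hub_structure 3 w P"
proof -
  interpret swap: degree_two_vertex V E v b a by (rule swapped)
  have "4 * card V \<le> card E + 10 \<and>
    (4 * card V = card E + 10 \<longrightarrow> (\<exists>w P. hub_structure 2 w P \<or> hub_structure 3 w P))"
  proof (cases "only_a = {} \<or> only_b = {}")
    case True
    then show ?thesis
      using strict_if_only_a_empty swap.strict_if_only_a_empty by (auto simp: swapped_classes)
  next
    case False
    then have ne: "only_a \<noteq> {}" "only_b \<noteq> {}" by auto
    let ?C = "{z \<in> both. \<exists>s\<in>only_a \<union> only_b. (z, s) \<in> E}"
    have "only_a \<inter> only_b = {}" "(only_a \<union> only_b) \<inter> ?C = {}"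
      using disjoint_classes by auto
    then have card_cross: "card cross = card only_a + card only_b + card ?C"
      unfolding cross_def by (simp add: card_Un_disjoint)
    note bound = cross_arcs_bound[OF ne]
    have "4 * card V \<le> card E + 10"
      using bound card_cross card_E_eq by auto
    moreover have "\<exists>w P. hub_structure 2 w P \<or> hub_structure 3 w P" if eq: "4 * card V = card E + 10"
    proof -
      have ab: "(a, b) \<notin> E"
        using bound card_cross card_E_eq eq by (auto split: if_splits)
      have count: "arcs_between rest rest + 2 = 2 * (card only_a + card only_b)"
        using card_E_eq eq ab by simp
      then have "card ?C = 0" using bound card_cross by simp
      then have noC: "(s, z) \<notin> E" if "z \<in> both" "s \<in> only_a \<union> only_b" for z s
        using that by (auto dest: adj_sym)
      \<comment> \<open>The subgraph on the one-sided classes has fewer edges than vertices, hence a leaf.\<close>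
      have "\<exists>l\<in>only_a \<union> only_b. card (nbrs l \<inter> rest) \<le> 1"
      proof (rule ccontr)
        assume "\<not> ?thesis"
        then have "\<And>s. s \<in> only_a \<union> only_b \<Longrightarrow> 2 \<le> card (nbrs s \<inter> rest)" by force
        then have "2 * card (only_a \<union> only_b) \<le> arcs_between (only_a \<union> only_b) rest"
          using sum_bounded_below[of "only_a \<union> only_b" 2 "\<lambda>s. card (nbrs s \<inter> rest)"]
          by (simp add: arcs_between_eq_sum mult.commute)
        also have "\<dots> \<le> arcs_between rest rest"
          using rest_eq by (intro arcs_between_mono) auto
        finally show False
          using count disjoint_classes(1) by (simp add: card_Un_disjoint)
      qed
      then obtain l where l: "l \<in> only_a \<or> l \<in> only_b" "card (nbrs l \<inter> rest) \<le> 1" by blast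
      from l(1) show ?thesis
      proof
        assume "l \<in> only_a"
        then show ?thesis using leaf_structure ne ab noC count l(2) by simp
      next
        assume "l \<in> only_b"
        moreover have "(b, a) \<notin> E" using ab adj_sym by blast
        ultimately show ?thesis
          using swap.leaf_structure[of l] ne noC count l(2)
          by (simp add: swapped_classes Un_commute add.commute)
      qed
    qed
    ultimately show ?thesis by blast
  qed
  then show "4 * card V \<le> card E + 10"
    and "4 * card V = card E + 10 \<Longrightarrow> \<exists>w P. hub_structure 2 w P \<or> hub_structure 3 w P"
    by blast+
qed

end

section \<open>The arc bound\<close>

lemma (in biconnected_diameter_two) arc_bound:
  "4 * card V \<le> card E + 10"
  and arc_bound_equality:
  "4 * card V = card E + 10 \<Longrightarrow>
    (\<exists>w P. hub_structure 2 w P \<or> hub_structure 3 w P) \<or> petersen_structure"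
proof -
  have "4 * card V \<le> card E + 10 \<and> (4 * card V = card E + 10 \<longrightarrow>
    (\<exists>w P. hub_structure 2 w P \<or> hub_structure 3 w P) \<or> petersen_structure)"
  proof (cases "\<exists>v\<in>V. card (nbrs v) = 2")
    case True
    then obtain v a b where "v \<in> V" "nbrs v = {a, b}" "a \<noteq> b"
      by (auto simp: card_2_iff)
    then interpret degree_two_vertex V E v a b by unfold_locales
    show ?thesis using degree_two_bound by blast
  next
    case no2: False
    have min3: "3 \<le> card (nbrs u)" if "u \<in> V" for u
      using no2 degree_ge_2[OF that] that by (metis Suc_leI le_neq_implies_less numeral_2_eq_2 numeral_3_eq_3)
    show ?thesis
    proof (cases "\<exists>v\<in>V. card (nbrs v) = 3")
      case True
      then obtain v where v: "v \<in> V" "card (nbrs v) = 3" by blast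
      have petersen_structure if eq: "4 * card V = card E + 10"
      proof (rule petersen_labelling)
        show "card V = 10" using extremal_min_degree_three(1)[OF min3 v eq] .
        show "card (nbrs u) = 3" if "u \<in> V" for u
          using extremal_min_degree_three(2)[OF min3 v eq that] .
        show "(x, y) \<notin> E" if "(u, x) \<in> E" "(u, y) \<in> E" for u x y
          using extremal_min_degree_three(3)[OF min3 v eq that] .
        show "x = y" if "u \<noteq> w" "(u, x) \<in> E" "(u, y) \<in> E" "(w, x) \<in> E" "(w, y) \<in> E" for u w x y
          using extremal_min_degree_three(4)[OF min3 v eq that] .
      qed
      then show ?thesis
        using degree_three_bound(1)[OF min3 v] by blast
    next
      case False
      have "4 \<le> card (nbrs u)" if "u \<in> V" for u
      proof -
        have "card (nbrs u) \<noteq> 3" using False that by blast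
        then show ?thesis using min3[OF that] by simp
      qed
      then have "4 * card V \<le> card E"
        using sum_bounded_below[of V 4 "\<lambda>u. card (nbrs u)"] sum_degrees by (simp add: mult.commute)
      then show ?thesis by simp
    qed
  qed
  then show "4 * card V \<le> card E + 10"
    "4 * card V = card E + 10 \<Longrightarrow>
      (\<exists>w P. hub_structure 2 w P \<or> hub_structure 3 w P) \<or> petersen_structure" by blast+
qed

section \<open>Isomorphisms and arc counts\<close>

lemma pair_graph_simple_graph: "pair_graph G \<Longrightarrow> simple_graph (pverts G) (parcs G)"
proof -
  assume "pair_graph G"
  then interpret pair_graph G .
  have "parcs G \<subseteq> pverts G \<times> pverts G"
    by (auto dest: in_arcsD1 in_arcsD2)
  moreover have "sym (parcs G)"
    using pair_sym_arcs by (simp add: symmetric_def)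
  moreover have "irrefl (parcs G)"
    using pair_no_loops by (fastforce simp: irrefl_def)
  ultimately show ?thesis
    using pair_finite_verts by unfold_locales
qed

lemma card_parcs:
  assumes "pair_graph G"
  shows "card (parcs G) = 2 * card (edges G)"
proof -
  interpret simple_graph "pverts G" "parcs G" by (rule pair_graph_simple_graph[OF assms])
  let ?f = "\<lambda>(u, w). {u, w}"
  have "card (parcs G) = (\<Sum>e\<in>edges G. card {p \<in> parcs G. ?f p = e})"
    unfolding edges_def using sum.image_gen[of "parcs G" "\<lambda>_. 1::nat" ?f] by simp
  also have "\<dots> = (\<Sum>e\<in>edges G. 2)"
  proof (rule sum.cong)
    fix e assume "e \<in> edges G"
    then obtain u w where uw: "e = {u, w}" "(u, w) \<in> parcs G" by (auto simp: edges_def)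
    then have "{p \<in> parcs G. ?f p = e} = {(u, w), (w, u)}"
      using adj_sym by (auto simp: doubleton_eq_iff)
    then show "card {p \<in> parcs G. ?f p = e} = 2"
      using adj_neq[OF uw(2)] by simp
  qed simp
  finally show ?thesis by simp
qed

text \<open>
  An isomorphism between digraphs has separate components for arcs and their ends; between graphs whose
  arcs are pairs, the map on vertices determines them.
\<close>

lemma digraph_isoI:
  assumes wf: "wf_digraph (with_proj G)"
    and bij: "bij_betw f (pverts G) (pverts H)"
    and arcs: "parcs H = (\<lambda>(u, w). (f u, f w)) ` parcs G"
  shows "digraph_iso (with_proj G) (with_proj H)"
proof -
  interpret wf_digraph "with_proj G" by fact
  let ?h = "\<lparr>iso_verts = f, iso_arcs = (\<lambda>(u, w). (f u, f w)), iso_head = snd, iso_tail = fst\<rparr>"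
  have sub: "parcs G \<subseteq> pverts G \<times> pverts G"
    using tail_in_verts head_in_verts by (auto simp: mem_Times_iff)
  have inj: "inj_on f (pverts G)" using bij by (simp add: bij_betw_def)
  have "inj_on (\<lambda>(u, w). (f u, f w)) (parcs G)"
    using sub inj by (auto simp: inj_on_def)
  then have "pre_digraph.digraph_isomorphism (with_proj G) ?h"
    using wf inj by (auto simp: pre_digraph.digraph_isomorphism_def)
  moreover have "with_proj H = app_iso ?h (with_proj G)"
    using bij arcs by (simp add: with_proj_def app_iso_def bij_betw_def)
  ultimately show ?thesis
    unfolding digraph_iso_def by blast
qed

lemma digraph_iso_same_counts:
  assumes "digraph_iso (with_proj G) (with_proj H)"
  shows "card (pverts G) = card (pverts H)" "card (parcs G) = card (parcs H)"
proof -
  obtain f where f: "pre_digraph.digraph_isomorphism (with_proj G) f" "with_proj H = app_iso f (with_proj G)"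
    using assms by (auto simp: digraph_iso_def)
  then have "pverts H = iso_verts f ` pverts G" "parcs H = iso_arcs f ` parcs G"
    by (metis verts_app_iso with_proj_simps(1), metis arcs_app_iso with_proj_simps(2))
  then show "card (pverts G) = card (pverts H)" "card (parcs G) = card (parcs H)"
    using f(1) by (simp_all add: pre_digraph.digraph_isomorphism_def card_image)
qed

text \<open>
  The map on arcs is injective as well, so by the arc count it is onto. The map is given from the
  concrete graph \<open>H\<close> into \<open>G\<close>, the direction in which it is easy to define.
\<close>

lemma digraph_iso_if_spanning_embedding:
  assumes G: "pair_graph G" and inj: "inj_on f (pverts H)" and onto: "f ` pverts H = pverts G"
    and wfH: "parcs H \<subseteq> pverts H \<times> pverts H"
    and hom: "\<And>x y. (x, y) \<in> parcs H \<Longrightarrow> (f x, f y) \<in> parcs G"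
    and card: "card (parcs G) \<le> card (parcs H)"
  shows "digraph_iso (with_proj G) (with_proj H)"
proof -
  interpret G: simple_graph "pverts G" "parcs G" by (rule pair_graph_simple_graph[OF G])
  interpret pair_graph G by fact
  let ?F = "\<lambda>(x, y). (f x, f y)"
  have injF: "inj_on ?F (parcs H)"
    using wfH inj by (auto simp: inj_on_def)
  have sub: "?F ` parcs H \<subseteq> parcs G" using hom by auto
  have arcs: "parcs G = ?F ` parcs H"
    using card_subset_eq[OF G.finite_E sub] card card_mono[OF G.finite_E sub] card_image[OF injF] by simp
  let ?g = "the_inv_into (pverts H) f"
  have inv: "?g (f x) = x" if "x \<in> pverts H" for x using that inj by (rule the_inv_into_f_f[rotated])
  show ?thesis
  proof (rule digraph_isoI)
    show "wf_digraph (with_proj G)" by unfold_locales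
    show "bij_betw ?g (pverts G) (pverts H)"
      using bij_betw_the_inv_into[of f "pverts H" "pverts G"] inj onto by (simp add: bij_betw_def)
    have "(\<lambda>(u, w). (?g u, ?g w)) ` ?F ` parcs H = (\<lambda>p. p) ` parcs H"
      unfolding image_image using wfH inv by (intro image_cong) auto
    then show "parcs H = (\<lambda>(u, w). (?g u, ?g w)) ` parcs G"
      by (simp add: arcs)
  qed
qed

section \<open>The families of subdivided multigraphs\<close>

text \<open>
  The multiplicities \<open>m 1, \<dots>, m k\<close> of the edges at \<open>0\<close> in the complete graph on \<open>{0..k}\<close>; in an edge
  \<open>{0, j}\<close> the other end is the maximum.
\<close>

definition hub_mult :: "nat \<Rightarrow> (nat \<Rightarrow> nat) \<Rightarrow> nat set \<Rightarrow> nat" where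
  "hub_mult k m e = (if \<exists>j\<in>{1..k}. e = {0, j} then m (Max e) else 1)"

text \<open>
  The common generalisation of the two families: \<open>F\<^sub>p\<^sub>,\<^sub>q\<close> is the case \<open>k = 2\<close> and \<open>G\<^sub>p\<^sub>,\<^sub>q\<^sub>,\<^sub>r\<close> the case
  \<open>k = 3\<close>.
\<close>

definition hub_graph :: "nat \<Rightarrow> (nat \<Rightarrow> nat) \<Rightarrow> (nat + nat set \<times> nat) pair_pre_digraph" where
  "hub_graph k m = subdivide_edges {(e, i). 0 \<in> e}
     (multiply_edges (hub_mult k m) (complete_multigraph {0..k}))"

lemma F_graph_eq_hub_graph: "F_graph p q = hub_graph 2 (\<lambda>j. if j = 1 then p else q)"
proof -
  have "(\<lambda>e. if e = {0, 1} then p else if e = {0, 2} then q else 1) = hub_mult 2 (\<lambda>j. if j = 1 then p else q)"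
  proof
    fix e :: "nat set"
    have i: "{1..2} = {1, 2::nat}" by auto
    show "(if e = {0, 1} then p else if e = {0, 2} then q else 1) = hub_mult 2 (\<lambda>j. if j = 1 then p else q) e"
      unfolding hub_mult_def i by (auto simp: doubleton_eq_iff)
  qed
  moreover have "{0, 1, 2} = {0..2::nat}" by auto
  ultimately show ?thesis by (simp add: F_graph_def hub_graph_def)
qed

lemma G_graph_eq_hub_graph:
  "G_graph p q r = hub_graph 3 (\<lambda>j. if j = 1 then p else if j = 2 then q else r)"
proof -
  have "(\<lambda>e. if e = {0, 1} then p else if e = {0, 2} then q else if e = {0, 3} then r else 1)
    = hub_mult 3 (\<lambda>j. if j = 1 then p else if j = 2 then q else r)"
  proof
    fix e :: "nat set"
    have i: "{1..3} = {1, 2, 3::nat}" by auto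
    show "(if e = {0, 1} then p else if e = {0, 2} then q else if e = {0, 3} then r else 1)
      = hub_mult 3 (\<lambda>j. if j = 1 then p else if j = 2 then q else r) e"
      unfolding hub_mult_def i by (auto simp: doubleton_eq_iff)
  qed
  moreover have "{0, 1, 2, 3} = {0..3::nat}" by auto
  ultimately show ?thesis by (simp add: G_graph_def hub_graph_def)
qed

definition spokes :: "nat \<Rightarrow> (nat \<Rightarrow> nat) \<Rightarrow> (nat \<times> nat) set" where
  "spokes k m = (SIGMA j:{1..k}. {..<m j})"

lemma card_2_with_0:
  "(0::nat) \<in> e \<and> card e = 2 \<and> e \<subseteq> {0..k} \<longleftrightarrow> (\<exists>j\<in>{1..k}. e = {0, j})"
proof
  assume e: "0 \<in> e \<and> card e = 2 \<and> e \<subseteq> {0..k}"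
  then obtain x y where "e = {x, y}" "x \<noteq> y" by (auto simp: card_2_iff)
  then obtain j where "e = {0, j}" "j \<noteq> 0" using e by auto
  then show "\<exists>j\<in>{1..k}. e = {0, j}" using e by auto
qed auto

lemma spoke_names:
  "{(e, i). e \<subseteq> {0..k} \<and> card e = 2 \<and> i < hub_mult k m e} \<inter> {(e, i). 0 \<in> e}
     = (\<lambda>(j, i). ({0, j}, i)) ` spokes k m" (is "?L = ?R")
proof (intro set_eqI iffI)
  fix x assume "x \<in> ?L"
  then obtain e i where x: "x = (e, i)" "0 \<in> e \<and> card e = 2 \<and> e \<subseteq> {0..k}" "i < hub_mult k m e" by auto
  then obtain j where j: "j \<in> {1..k}" "e = {0, j}" using card_2_with_0[of e k] by blast
  then have "hub_mult k m e = m j" by (auto simp: hub_mult_def)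
  then have "(j, i) \<in> spokes k m" using x(3) j by (auto simp: spokes_def)
  then show "x \<in> ?R" using x(1) j by force
next
  fix x assume "x \<in> ?R"
  then obtain j i where x: "x = ({0, j}, i)" "j \<in> {1..k}" "i < m j" by (auto simp: spokes_def)
  then have "hub_mult k m {0, j} = m j" by (auto simp: hub_mult_def)
  then show "x \<in> ?L" using x by auto
qed

lemma rim_names:
  "{(e, i). e \<subseteq> {0..k} \<and> card e = 2 \<and> i < hub_mult k m e} - {(e, i). 0 \<in> e}
     = {({x, y}, 0) | x y. x \<in> {1..k} \<and> y \<in> {1..k} \<and> x \<noteq> y}" (is "?L = ?R")
proof (intro set_eqI iffI)
  fix z assume "z \<in> ?L"
  then obtain e i where z: "z = (e, i)" "0 \<notin> e" "card e = 2" "e \<subseteq> {0..k}" "i < hub_mult k m e" by auto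
  then obtain x y where xy: "e = {x, y}" "x \<noteq> y" by (auto simp: card_2_iff)
  moreover have "x \<in> {1..k}" "y \<in> {1..k}" using xy z(2,4) by (auto simp: Suc_le_eq)
  moreover have "i = 0" using z(2,5) by (auto simp: hub_mult_def split: if_splits)
  ultimately show "z \<in> ?R" using z(1) by blast
next
  fix z assume "z \<in> ?R"
  then obtain x y where z: "z = ({x, y}, 0)" "x \<in> {1..k}" "y \<in> {1..k}" "x \<noteq> y" by blast
  moreover from z have "hub_mult k m {x, y} = 1" by (auto simp: hub_mult_def)
  ultimately show "z \<in> ?L" by auto
qed

lemma pverts_hub_graph:
  "pverts (hub_graph k m) = Inl ` {0..k} \<union> (\<lambda>(j, i). Inr ({0, j}, i)) ` spokes k m"
  by (simp add: hub_graph_def subdivide_edges_def multiply_edges_def complete_multigraph_def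
      spoke_names[unfolded split_def] image_image split_def)

lemma parcs_hub_graph:
  "parcs (hub_graph k m) =
     {(Inl x, Inl y) | x y. x \<in> {1..k} \<and> y \<in> {1..k} \<and> x \<noteq> y}
     \<union> {(Inl x, Inr ({0, j}, i)) | x j i. (j, i) \<in> spokes k m \<and> x \<in> {0, j}}
     \<union> {(Inr ({0, j}, i), Inl x) | x j i. (j, i) \<in> spokes k m \<and> x \<in> {0, j}}" (is "_ = ?A \<union> ?B \<union> ?C")
proof -
  let ?S = "(\<lambda>(j, i). ({0, j}, i)) ` spokes k m"
  let ?R = "{({x, y}, 0::nat) | x y. x \<in> {1..k} \<and> y \<in> {1..k} \<and> x \<noteq> y}"
  have "{(Inl x, Inl y) | x y e. e \<in> ?R \<and> fst e = {x, y}} = ?A"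
    by (auto simp: doubleton_eq_iff)
  moreover have "{(Inl x, Inr e) | x e. e \<in> ?S \<and> x \<in> fst e} = ?B"
    by (force simp: image_iff)
  moreover have "{(Inr e, Inl x) | x e. e \<in> ?S \<and> x \<in> fst e} = ?C"
    by (force simp: image_iff)
  ultimately show ?thesis
    by (simp add: hub_graph_def subdivide_edges_def multiply_edges_def complete_multigraph_def
      spoke_names[unfolded split_def] rim_names[unfolded split_def] split_def)
qed

lemma finite_spokes [simp]: "finite (spokes k m)"
  by (simp add: spokes_def)

lemma card_pverts_hub_graph: "card (pverts (hub_graph k m)) = k + 1 + card (spokes k m)"
proof -
  have "inj_on (\<lambda>(j, i). Inr ({0, j}, i)) (spokes k m)"
    by (auto simp: inj_on_def spokes_def doubleton_eq_iff)
  then have "card ((\<lambda>(j, i). Inr ({0, j}, i) :: nat + nat set \<times> nat) ` spokes k m) = card (spokes k m)"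
    by (rule card_image)
  moreover have "card (Inl ` {0..k} :: (nat + nat set \<times> nat) set) = k + 1"
    by (simp add: card_image)
  ultimately show ?thesis
    unfolding pverts_hub_graph by (subst card_Un_disjoint) auto
qed

lemma card_parcs_hub_graph: "card (parcs (hub_graph k m)) = k * (k - 1) + 4 * card (spokes k m)"
proof -
  let ?A = "{(Inl x, Inl y) | x y. x \<in> {1..k} \<and> y \<in> {1..k} \<and> x \<noteq> y}
      :: ((nat + nat set \<times> nat) \<times> (nat + nat set \<times> nat)) set"
  let ?B = "{(Inl x, Inr ({0, j}, i)) | x j i. (j, i) \<in> spokes k m \<and> x \<in> {0, j}}
      :: ((nat + nat set \<times> nat) \<times> (nat + nat set \<times> nat)) set"
  let ?C = "{(Inr ({0, j}, i), Inl x) | x j i. (j, i) \<in> spokes k m \<and> x \<in> {0, j}}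
      :: ((nat + nat set \<times> nat) \<times> (nat + nat set \<times> nat)) set"
  have "?A = (\<lambda>(x, y). (Inl x, Inl y)) ` (SIGMA x:{1..k}. {1..k} - {x})"
    by auto
  moreover have "card \<dots> = card (SIGMA x:{1..k}. {1..k} - {x})"
    by (rule card_image) (auto simp: inj_on_def)
  moreover have "card (SIGMA x:{1..k}. {1..k} - {x}) = k * (k - 1)"
    by simp
  ultimately have A: "finite ?A" "card ?A = k * (k - 1)" by simp_all
  have "?B = (\<lambda>((j, i), x). (Inl x, Inr ({0, j}, i))) ` (SIGMA s:spokes k m. {0, fst s})"
    by (force simp: image_iff)
  moreover have "card \<dots> = card (SIGMA s:spokes k m. {0, fst s})"
    by (rule card_image) (auto simp: inj_on_def doubleton_eq_iff spokes_def)
  moreover have "card (SIGMA s:spokes k m. {0, fst s}) = (\<Sum>s\<in>spokes k m. 2)"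
  proof -
    have "card {0, fst s} = 2" if "s \<in> spokes k m" for s
      using that by (auto simp: spokes_def)
    then show ?thesis by simp
  qed
  ultimately have B: "finite ?B" "card ?B = 2 * card (spokes k m)" by simp_all
  have "?C = prod.swap ` ?B"
    by (force simp: image_iff)
  then have C: "finite ?C" "card ?C = 2 * card (spokes k m)"
    using B by (simp_all add: card_image)
  have "card (?A \<union> ?B) = card ?A + card ?B"
    using A B by (intro card_Un_disjoint) auto
  moreover have "card ((?A \<union> ?B) \<union> ?C) = card (?A \<union> ?B) + card ?C"
    using A B C by (intro card_Un_disjoint) auto
  ultimately show ?thesis
    unfolding parcs_hub_graph using A B C by simp
qed

lemma hub_graph_wf: "parcs (hub_graph k m) \<subseteq> pverts (hub_graph k m) \<times> pverts (hub_graph k m)"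
  unfolding parcs_hub_graph pverts_hub_graph by (force simp: spokes_def)

lemma hub_graph_cong:
  assumes "\<And>j. j \<in> {1..k} \<Longrightarrow> m j = m' j"
  shows "hub_graph k m = hub_graph k m'"
proof -
  have "hub_mult k m = hub_mult k m'"
    using assms by (auto simp: hub_mult_def fun_eq_iff)
  then show ?thesis by (simp add: hub_graph_def)
qed

text \<open>
  The vertices of the clique and the hub are mapped along \<open>w\<close>, and the vertices subdividing the edges
  \<open>{0, j}\<close> along an enumeration of \<open>P j\<close>. The count \<open>4 n - 10\<close> agrees with the number of arcs of the
  hub graph exactly when \<open>k * (k - 1) = 4 * k - 6\<close>, which is where \<open>k = 2 \<or> k = 3\<close> enters.
\<close>

lemma digraph_iso_hub_graph:
  assumes G: "pair_graph G" and k: "k = 2 \<or> k = 3"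
    and count: "card (parcs G) + 10 = 4 * card (pverts G)"
    and hub: "simple_graph.hub_structure (pverts G) (parcs G) k w P"
  shows "digraph_iso (with_proj G) (with_proj (hub_graph k (\<lambda>j. card (P j))))"
proof -
  interpret simple_graph "pverts G" "parcs G" by (rule pair_graph_simple_graph[OF G])
  let ?m = "\<lambda>j. card (P j)"
  let ?H = "hub_graph k ?m"
  have w_inj: "inj_on w {0..k}" and V: "pverts G = w ` {0..k} \<union> (\<Union>j\<in>{1..k}. P j)"
    and Pw: "\<And>j. j \<in> {1..k} \<Longrightarrow> P j \<inter> w ` {0..k} = {}"
    and disj: "disjoint_family_on P {1..k}"
    and rim: "\<And>i j. i \<in> {1..k} \<Longrightarrow> j \<in> {1..k} \<Longrightarrow> i \<noteq> j \<Longrightarrow> (w i, w j) \<in> parcs G"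
    and spoke: "\<And>j x. j \<in> {1..k} \<Longrightarrow> x \<in> P j \<Longrightarrow> (w 0, x) \<in> parcs G \<and> (w j, x) \<in> parcs G"
    using hub unfolding hub_structure_def by blast+
  have fin: "finite (P j)" if "j \<in> {1..k}" for j
    using that V finite_V by (metis UN_I UnI2 finite_subset subsetI)
  \<comment> \<open>Choose for each class a numbering of its vertices by the indices of the parallel edges.\<close>
  have "\<exists>g. bij_betw g {..<card (P j)} (P j)" if "j \<in> {1..k}" for j
    using ex_bij_betw_nat_finite[OF fin[OF that]] by (simp add: atLeast0LessThan)
  then obtain g where g: "\<And>j. j \<in> {1..k} \<Longrightarrow> bij_betw (g j) {..<card (P j)} (P j)"
    by metis
  \<comment> \<open>The only edge names used are \<open>{0, j}\<close>, and \<open>Max {0, j} = j\<close> recovers the class.\<close>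
  define f where "f = (\<lambda>x. case x of Inl i \<Rightarrow> w i | Inr (e, i) \<Rightarrow> g (Max e) i)"
  have f_Inl: "f (Inl i) = w i" for i by (simp add: f_def)
  have f_Inr: "f (Inr ({0, j}, i)) = g j i" for j i by (simp add: f_def)
  have g_in: "g j i \<in> P j" if "(j, i) \<in> spokes k ?m" for j i
    using g[of j] that by (auto simp: spokes_def bij_betw_def)
  have onto: "f ` pverts ?H = pverts G"
  proof -
    have "(\<lambda>(j, i). f (Inr ({0, j}, i))) ` spokes k ?m = (\<Union>j\<in>{1..k}. g j ` {..<card (P j)})"
      unfolding spokes_def f_Inr by force
    also have "\<dots> = (\<Union>j\<in>{1..k}. P j)"
      using g by (simp add: bij_betw_def)
    finally show ?thesis
      unfolding pverts_hub_graph V by (simp add: image_Un image_image f_Inl split_def)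
  qed
  have card_V: "card (pverts G) = card (pverts ?H)"
  proof -
    have "card (\<Union>j\<in>{1..k}. P j) = card (spokes k ?m)"
    proof -
      have "card (\<Union>j\<in>{1..k}. P j) = (\<Sum>j\<in>{1..k}. card (P j))"
        using disj fin by (intro card_UN_disjoint) (auto simp: disjoint_family_on_def)
      then show ?thesis by (simp add: spokes_def)
    qed
    moreover have "card (w ` {0..k}) = k + 1" using card_image[OF w_inj] by simp
    moreover have "card (pverts G) = card (w ` {0..k}) + card (\<Union>j\<in>{1..k}. P j)"
    proof -
      have "w ` {0..k} \<inter> (\<Union>j\<in>{1..k}. P j) = {}" using Pw by blast
      then show ?thesis unfolding V using fin by (intro card_Un_disjoint) auto
    qed
    ultimately show ?thesis by (simp add: card_pverts_hub_graph)
  qed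
  have inj: "inj_on f (pverts ?H)"
    using eq_card_imp_inj_on[of "pverts ?H" f] onto card_V by (simp add: pverts_hub_graph)
  have spoke_f: "(f (Inl x), f (Inr ({0, j}, i))) \<in> parcs G" if "(j, i) \<in> spokes k ?m" "x \<in> {0, j}" for x j i
    using spoke[of j "g j i"] g_in[OF that(1)] that by (auto simp: f_Inl f_Inr spokes_def)
  have hom: "(f x, f y) \<in> parcs G" if "(x, y) \<in> parcs ?H" for x y
    using that unfolding parcs_hub_graph
  proof (elim UnE CollectE exE conjE)
    fix i j assume "(x, y) = (Inl i, Inl j)" "i \<in> {1..k}" "j \<in> {1..k}" "i \<noteq> j"
    then show ?thesis using rim by (simp add: f_Inl)
  next
    fix i j l assume "(x, y) = (Inl i, Inr ({0, j}, l))" "(j, l) \<in> spokes k ?m" "i \<in> {0, j}"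
    then show ?thesis using spoke_f by blast
  next
    fix i j l assume "(x, y) = (Inr ({0, j}, l), Inl i)" "(j, l) \<in> spokes k ?m" "i \<in> {0, j}"
    then show ?thesis using spoke_f adj_sym by blast
  qed
  have "card (parcs G) \<le> card (parcs ?H)"
    using k count card_V by (auto simp: card_pverts_hub_graph card_parcs_hub_graph)
  then show ?thesis
    using digraph_iso_if_spanning_embedding[OF G inj onto hub_graph_wf hom] by blast
qed

section \<open>The Petersen graph\<close>

lemma card_two_subsets_of_5: "card {s. s \<subseteq> {0..<5::nat} \<and> card s = 2} = 10"
  using n_subsets[of "{0..<5::nat}" 2] by (simp add: numeral_eq_Suc)

text \<open>
  The two-element sets disjoint from a given one are those of the remaining three elements.
\<close>

lemma card_petersen: "card (pverts petersen) = 10" "card (parcs petersen) = 30"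
proof -
  let ?P = "{s. s \<subseteq> {0..<5::nat} \<and> card s = 2}"
  note P = card_two_subsets_of_5
  then show "card (pverts petersen) = 10" by (simp add: petersen_def)
  have disj: "card {t. t \<subseteq> {0..<5::nat} - s \<and> card t = 2} = 3" if "s \<in> ?P" for s
  proof -
    have "card ({0..<5::nat} - s) = 3" using that finite_subset[of s "{0..<5}"] by (simp add: card_Diff_subset)
    then show ?thesis using n_subsets[of "{0..<5::nat} - s" 2] by (simp add: numeral_eq_Suc)
  qed
  have "parcs petersen = (SIGMA s:?P. {t. t \<subseteq> {0..<5} - s \<and> card t = 2})"
    by (auto simp: petersen_def)
  then have "card (parcs petersen) = (\<Sum>s\<in>?P. card {t. t \<subseteq> {0..<5} - s \<and> card t = 2})"
    by simp
  also have "\<dots> = 30" using disj P by simp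
  finally show "card (parcs petersen) = 30" .
qed

lemma two_subsets_of_5:
  "{s. s \<subseteq> {0..<5} \<and> card s = 2} =
     {{0, 1}, {0, 2}, {0, 3}, {0, 4}, {1, 2}, {1, 3}, {1, 4}, {2, 3}, {2, 4}, {3, 4::nat}}" (is "?L = ?R")
proof (rule card_subset_eq[symmetric])
  show "finite ?L" by simp
  show "?R \<subseteq> ?L" by auto
  show "card ?R = card ?L"
    unfolding card_two_subsets_of_5 by (simp add: doubleton_eq_iff)
qed

text \<open>
  The labels of the Kneser graph are found from \<open>v = {0, 1}\<close>: its neighbours are the pairs in
  \<open>{2, 3, 4}\<close>, and along the hexagon consecutive pairs are disjoint.
\<close>

lemma digraph_iso_petersen:
  assumes G: "pair_graph G" and card_E: "card (parcs G) = 30"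
    and petersen: "simple_graph.petersen_structure (pverts G) (parcs G)"
  shows "digraph_iso (with_proj G) (with_proj petersen)"
proof -
  interpret simple_graph "pverts G" "parcs G" by (rule pair_graph_simple_graph[OF G])
  obtain v x1 x2 x3 a a' b b' c c' where
    V: "pverts G = {v, x1, x2, x3, a, a', b, b', c, c'}"
    and arcs: "{(v, x1), (v, x2), (v, x3), (x1, a), (x1, a'), (x2, b), (x2, b'), (x3, c), (x3, c'),
      (a, b), (b, c), (c, a'), (a', b'), (b', c'), (c', a)} \<subseteq> parcs G"
    and card_V: "card (pverts G) = 10"
    using petersen unfolding petersen_structure_def by (elim conjE exE)
  define f where "f s = the (map_of [({0, 1}, v), ({2, 3}, x1), ({2, 4}, x2), ({3, 4}, x3),
    ({0, 4}, a), ({1, 4}, a'),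
    ({1, 3}, b), ({0, 3}, b'), ({0, 2}, c), ({1, 2::nat}, c')] s)" for s
  have f: "f {0, 1} = v" "f {2, 3} = x1" "f {2, 4} = x2" "f {3, 4} = x3" "f {0, 4} = a" "f {1, 4} = a'"
    "f {1, 3} = b" "f {0, 3} = b'" "f {0, 2} = c" "f {1, 2} = c'"
    by (simp_all add: f_def doubleton_eq_iff)
  have P: "pverts petersen = {{0, 1}, {0, 2}, {0, 3}, {0, 4}, {1, 2}, {1, 3}, {1, 4}, {2, 3}, {2, 4}, {3, 4}}"
    by (simp add: petersen_def two_subsets_of_5)
  have wf: "parcs petersen \<subseteq> pverts petersen \<times> pverts petersen"
    by (auto simp: petersen_def)
  have onto: "f ` pverts petersen = pverts G"
    unfolding P V image_insert image_empty f by blast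
  have inj: "inj_on f (pverts petersen)"
    using eq_card_imp_inj_on[of "pverts petersen" f] onto card_V card_petersen by (simp add: P)
  have e: "(v, x1) \<in> parcs G" "(v, x2) \<in> parcs G" "(v, x3) \<in> parcs G"
    "(x1, a) \<in> parcs G" "(x1, a') \<in> parcs G" "(x2, b) \<in> parcs G" "(x2, b') \<in> parcs G"
    "(x3, c) \<in> parcs G" "(x3, c') \<in> parcs G" "(a, b) \<in> parcs G" "(b, c) \<in> parcs G"
    "(c, a') \<in> parcs G" "(a', b') \<in> parcs G" "(b', c') \<in> parcs G" "(c', a) \<in> parcs G"
    using arcs by simp_all
  note e_rev = e[THEN adj_sym]
  have "\<forall>s\<in>pverts petersen. \<forall>t\<in>pverts petersen. s \<inter> t = {} \<longrightarrow> (f s, f t) \<in> parcs G"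
    unfolding P by (simp add: f e e_rev del: One_nat_def)
  moreover have "s \<inter> t = {}" if "(s, t) \<in> parcs petersen" for s t
    using that by (simp add: petersen_def)
  ultimately have hom: "(f s, f t) \<in> parcs G" if "(s, t) \<in> parcs petersen" for s t
    using that wf by blast
  show ?thesis
    using digraph_iso_if_spanning_embedding[OF G inj onto wf hom] card_E card_petersen by simp
qed

section \<open>Distances and cut-vertices\<close>

text \<open>
  If \<open>u\<close> does not reach \<open>w\<close>, the set of vertices reached from \<open>u\<close> is a cut that no arc leaves.
\<close>

lemma rtrancl_on_cut:
  "(\<forall>u\<in>F. \<forall>w\<in>F. (u, w) \<in> rtrancl_on F r) \<longleftrightarrow>
     (\<forall>T\<subseteq>F. T \<noteq> {} \<longrightarrow> T \<noteq> F \<longrightarrow> (\<exists>x\<in>T. \<exists>y\<in>F - T. (x, y) \<in> r))" (is "?L \<longleftrightarrow> ?R")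
proof
  assume L: ?L
  show ?R
  proof (intro allI impI, rule ccontr)
    fix T assume T: "T \<subseteq> F" "T \<noteq> {}" "T \<noteq> F" and no: "\<not> (\<exists>x\<in>T. \<exists>y\<in>F - T. (x, y) \<in> r)"
    obtain t u where tu: "t \<in> T" "u \<in> F" "u \<notin> T" using T by auto
    then have "(t, u) \<in> rtrancl_on F r" using L T by blast
    then have "u \<in> T"
      by (induction rule: rtrancl_on_induct) (use tu no in blast)+
    then show False using tu by blast
  qed
next
  assume R: ?R
  show ?L
  proof (intro ballI, rule ccontr)
    fix u w assume u: "u \<in> F" and w: "w \<in> F" and nr: "(u, w) \<notin> rtrancl_on F r"
    let ?T = "{x \<in> F. (u, x) \<in> rtrancl_on F r}"
    have "u \<in> ?T" using u by simp
    then obtain x y where "x \<in> ?T" "y \<in> F - ?T" "(x, y) \<in> r"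
      using R[rule_format, of ?T] w nr by blast
    then show False using rtrancl_on_into_rtrancl_on[of u x F r y] by auto
  qed
qed

lemma connected_del_vert_iff:
  assumes G: "pair_graph G"
  shows "connected (pre_digraph.del_vert (with_proj G) v) \<longleftrightarrow>
    pverts G \<noteq> {} \<and> pverts G \<noteq> {v} \<and> simple_graph.connected_on (parcs G) (pverts G - {v})"
proof -
  interpret simple_graph "pverts G" "parcs G" by (rule pair_graph_simple_graph[OF G])
  let ?D = "pre_digraph.del_vert (with_proj G) v"
  have "arcs_ends ?D = {(x, y) \<in> parcs G. x \<noteq> v \<and> y \<noteq> v}"
    by (auto simp: arcs_ends_conv pre_digraph.del_vert_def image_iff)
  then have sym: "(arcs_ends ?D)\<^sup>s = {(x, y) \<in> parcs G. x \<noteq> v \<and> y \<noteq> v}"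
    by (auto simp: symcl_def intro: adj_sym)
  have verts: "verts ?D = pverts G - {v}" by (simp add: pre_digraph.del_vert_def)
  have "(\<exists>x\<in>T. \<exists>y\<in>pverts G - {v} - T. (x, y) \<in> {(x, y) \<in> parcs G. x \<noteq> v \<and> y \<noteq> v})
      \<longleftrightarrow> (\<exists>x\<in>T. \<exists>y\<in>pverts G - {v} - T. (x, y) \<in> parcs G)" if "T \<subseteq> pverts G - {v}" for T
    using that by auto
  moreover have "pverts G - {v} \<noteq> {} \<longleftrightarrow> pverts G \<noteq> {} \<and> pverts G \<noteq> {v}" by auto
  ultimately show ?thesis
    unfolding connected_conv rtrancl_on_cut connected_on_def sym verts by simp
qed

lemma graph_dist_le_2:
  assumes G: "pair_graph G" and d: "graph_dist G u w \<le> 2"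
  shows "u = w \<or> (u, w) \<in> parcs G \<or> (\<exists>x. (u, x) \<in> parcs G \<and> (x, w) \<in> parcs G)"
proof -
  interpret pair_graph G by fact
  have "graph_dist G u w < 3" using d by (rule le_less_trans) simp
  then obtain p where p: "awalk u p w" "ereal (awalk_cost (\<lambda>_. 1) p) < 3"
    unfolding graph_dist_def \<mu>_def by (auto simp: INF_less_iff)
  have "awalk_cost (\<lambda>_. 1) p = length p" by (induction p) auto
  then have "length p \<le> 2" using p(2) by simp
  then consider "p = []" | e where "p = [e]" | e e' where "p = [e, e']"
    by (auto simp: le_Suc_eq length_Suc_conv numeral_2_eq_2)
  then show ?thesis
    using p(1) by cases (auto simp: awalk_Cons_iff awalk_Nil_iff)
qed

lemma graph_dist_le_1:
  assumes G: "pair_graph G" and u: "u \<in> pverts G" and uw: "u = w \<or> (u, w) \<in> parcs G"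
  shows "graph_dist G u w \<le> 1"
proof -
  interpret pair_graph G by fact
  show ?thesis
  proof (cases "u = w")
    case True
    then have "awalk u [] w" using u by (simp add: awalk_Nil_iff)
    from min_cost_le_walk_cost[OF this, of "\<lambda>_. 1"] show ?thesis
      unfolding graph_dist_def by (auto simp: zero_ereal_def[symmetric] intro: order.trans)
  next
    case False
    then have "awalk u [(u, w)] w" using uw in_arcsD2 by (auto simp: awalk_Cons_iff awalk_Nil_iff)
    from min_cost_le_walk_cost[OF this, of "\<lambda>_. 1"] show ?thesis
      unfolding graph_dist_def by (simp add: one_ereal_def)
  qed
qed

lemma diameter_two_common_nbr:
  assumes G: "pair_graph G" and d: "diameter G = 2"
    and "u \<in> pverts G" "w \<in> pverts G" "u \<noteq> w" "(u, w) \<notin> parcs G"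
  shows "\<exists>x. (u, x) \<in> parcs G \<and> (x, w) \<in> parcs G"
proof -
  have "graph_dist G u w \<le> (SUP w\<in>pverts G. graph_dist G u w)" using assms by (intro SUP_upper)
  also have "\<dots> \<le> diameter G" unfolding diameter_def using assms by (intro SUP_upper)
  finally show ?thesis using graph_dist_le_2[OF G] assms by auto
qed

lemma diameter_two_nonadjacent:
  assumes G: "pair_graph G" and d: "diameter G = 2"
  obtains u w where "u \<in> pverts G" "w \<in> pverts G" "u \<noteq> w" "(u, w) \<notin> parcs G"
proof -
  have "\<exists>u\<in>pverts G. \<exists>w\<in>pverts G. u \<noteq> w \<and> (u, w) \<notin> parcs G"
  proof (rule ccontr)
    assume "\<not> ?thesis"
    then have "diameter G \<le> 1"
      unfolding diameter_def using graph_dist_le_1[OF G] by (intro SUP_least) auto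
    then show False using d by simp
  qed
  then show ?thesis using that by blast
qed

lemma diameter_two_card:
  assumes G: "pair_graph G" and d: "diameter G = 2"
  shows "3 \<le> card (pverts G)"
proof -
  interpret simple_graph "pverts G" "parcs G" by (rule pair_graph_simple_graph[OF G])
  obtain u w where uw: "u \<in> pverts G" "w \<in> pverts G" "u \<noteq> w" "(u, w) \<notin> parcs G"
    using diameter_two_nonadjacent[OF G d] .
  then obtain x where x: "(u, x) \<in> parcs G" "(x, w) \<in> parcs G"
    using diameter_two_common_nbr[OF G d] by blast
  have "{u, w, x} \<subseteq> pverts G" using uw x adj_in_V by blast
  then have "card {u, w, x} \<le> card (pverts G)" using finite_V by (rule card_mono[rotated])
  moreover have "x \<noteq> u" "x \<noteq> w" using x by auto
  ultimately show ?thesis using uw by auto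
qed

lemma biconnected_diameter_twoI:
  assumes G: "pair_graph G" and d: "diameter G = 2" and nc: "\<not> has_cut_vertex G"
  shows "biconnected_diameter_two (pverts G) (parcs G)"
proof -
  interpret simple_graph "pverts G" "parcs G" by (rule pair_graph_simple_graph[OF G])
  show ?thesis
  proof
    show "3 \<le> card (pverts G)" using diameter_two_card[OF G d] .
  next
    fix u w assume "u \<in> pverts G" "w \<in> pverts G" "u \<noteq> w" "(u, w) \<notin> parcs G"
    then show "\<exists>x. (u, x) \<in> parcs G \<and> (x, w) \<in> parcs G"
      using diameter_two_common_nbr[OF G d] by blast
  next
    fix v assume v: "v \<in> pverts G"
    have "pverts G \<noteq> {v}" using diameter_two_card[OF G d] by auto
    then show "connected_on (pverts G - {v})"
      using v nc connected_del_vert_iff[OF G] unfolding has_cut_vertex_def cut_vertex_def by blast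
  qed
qed

section \<open>Pebbling and cut-vertices\<close>

text \<open>
  By the pigeonhole principle some vertex carries four pebbles, and these suffice for distance two. The
  lemma makes the pebbling number a genuine least element: its defining property holds for some \<open>k\<close>.
\<close>

lemma solvable_if_4n_pebbles:
  assumes G: "pair_graph G" and d: "diameter G = 2" and r: "r \<in> pverts G"
    and size: "config_size G c = 4 * card (pverts G)"
  shows "solvable G r c"
proof -
  interpret simple_graph "pverts G" "parcs G" by (rule pair_graph_simple_graph[OF G])
  have "\<exists>u\<in>pverts G. 4 \<le> c u"
  proof (rule ccontr)
    assume "\<not> ?thesis"
    then have "\<And>u. u \<in> pverts G \<Longrightarrow> c u \<le> 3" by force
    then have "config_size G c \<le> 3 * card (pverts G)"
      unfolding config_size_def using sum_bounded_above[of "pverts G" c 3] by (simp add: mult.commute)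
    then show False using size r finite_V card_gt_0_iff by fastforce
  qed
  then obtain u where u: "u \<in> pverts G" "4 \<le> c u" by blast
  consider "u = r" | "(u, r) \<in> parcs G" | x where "u \<noteq> r" "(u, x) \<in> parcs G" "(x, r) \<in> parcs G"
    using diameter_two_common_nbr[OF G d u(1) r] by blast
  then show ?thesis
  proof cases
    case 1
    then show ?thesis using u unfolding solvable_def by (intro exI[of _ c]) auto
  next
    case 2
    have "pebbling_move G c (c(u := c u - 2, r := c r + 1))"
      using 2 u by (intro pebbling_move.intros) auto
    then have "(pebbling_move G)\<^sup>*\<^sup>* c (c(u := c u - 2, r := c r + 1))" by blast
    then show ?thesis unfolding solvable_def by (intro exI conjI) auto
  next
    case 3
    have ux: "u \<noteq> x" "x \<noteq> r" using 3 by auto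
    define c1 where "c1 = c(u := c u - 2, x := c x + 1)"
    define c2 where "c2 = c1(u := c1 u - 2, x := c1 x + 1)"
    have "pebbling_move G c c1" unfolding c1_def
      using 3 u by (intro pebbling_move.intros) auto
    moreover have "pebbling_move G c1 c2" unfolding c2_def
      using 3 u ux by (intro pebbling_move.intros) (auto simp: c1_def)
    moreover have "pebbling_move G c2 (c2(x := c2 x - 2, r := c2 r + 1))"
      using 3 ux by (intro pebbling_move.intros) (auto simp: c1_def c2_def)
    ultimately have "(pebbling_move G)\<^sup>*\<^sup>* c (c2(x := c2 x - 2, r := c2 r + 1))"
      by (meson converse_rtranclp_into_rtranclp rtranclp.rtrancl_refl)
    then show ?thesis unfolding solvable_def by (intro exI conjI) auto
  qed
qed

text \<open>
  At every moment at most one vertex can move. It lies in \<open>T\<close>, and its move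
  either stays in \<open>T\<close> and hands over the ability to move, or puts the first and only pebble on the cut-vertex \<open>x\<close>, after
  which nothing moves any more. The side of the root \<open>w\<close> is never reached.
\<close>

lemma cut_vertex_unsolvable:
  assumes G: "pair_graph G" and x: "x \<in> pverts G"
    and T: "T \<subseteq> pverts G - {x}" and u: "u \<in> T" and w: "w \<in> pverts G - {x} - T"
    and cut: "\<And>y z. y \<in> T \<Longrightarrow> z \<in> pverts G - {x} - T \<Longrightarrow> (y, z) \<notin> parcs G"
  defines "c0 \<equiv> (\<lambda>y. if y = u then 3 else if y = x \<or> y = w then 0 else 1)"
  shows "config_size G c0 = card (pverts G)" and "\<not> solvable G w c0"
proof -
  interpret simple_graph "pverts G" "parcs G" by (rule pair_graph_simple_graph[OF G])
  let ?R = "pverts G - {u, x, w}"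
  have dist: "u \<noteq> x" "u \<noteq> w" "x \<noteq> w" "u \<in> pverts G" "w \<in> pverts G" using T u w by auto
  have V: "pverts G = {u, x, w} \<union> ?R" using dist x by auto
  have "config_size G c0 = (\<Sum>y\<in>{u, x, w}. c0 y) + (\<Sum>y\<in>?R. c0 y)"
    unfolding config_size_def by (subst V, rule sum.union_disjoint) (use finite_V in auto)
  moreover have "(\<Sum>y\<in>{u, x, w}. c0 y) = 3" using dist by (simp add: c0_def)
  moreover have "(\<Sum>y\<in>?R. c0 y) = card ?R" by (simp add: c0_def)
  moreover have "card (pverts G) = card {u, x, w} + card ?R"
    by (subst V, rule card_Un_disjoint) (use finite_V in auto)
  ultimately show "config_size G c0 = card (pverts G)" using dist by simp
  \<comment> \<open>In \<open>one_mobile\<close> configurations only one vertex of \<open>T\<close> may move; in \<open>stuck\<close> ones none can.\<close>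
  define stuck where "stuck c \<longleftrightarrow> c w = 0 \<and> (\<forall>y. c y \<le> 1)" for c :: "'a \<Rightarrow> nat"
  define one_mobile where "one_mobile c \<longleftrightarrow> c w = 0 \<and> c x = 0 \<and> (\<exists>y\<in>T. c y \<le> 2 \<and> (\<forall>z. z \<noteq> y \<longrightarrow> c z \<le> 1))"
    for c :: "'a \<Rightarrow> nat"
  have target: "z = x \<or> z \<in> T" if "y \<in> T" "(y, z) \<in> parcs G" for y z
    using cut[OF that(1)] that(2) adj_in_V by blast
  have wT: "w \<notin> T" using w by auto
  have "c = c0 \<or> one_mobile c \<or> stuck c" if "(pebbling_move G)\<^sup>*\<^sup>* c0 c" for c
    using that
  proof (induction rule: rtranclp_induct)
    case base
    then show ?case by simp
  next
    case (step c d)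
    from step(2) obtain y z where yz: "(y, z) \<in> parcs G" "2 \<le> c y" "d = c(y := c y - 2, z := c z + 1)"
      by (auto elim: pebbling_move.cases)
    have yz': "y \<noteq> z" using yz(1) by auto
    from step(3) consider "c = c0" | "one_mobile c" | "stuck c" by blast
    then show ?case
    proof cases
      case 1
      then have "y = u" using yz(2) by (auto simp: c0_def split: if_splits)
      then consider "z = x" | "z \<in> T" using target u yz(1) by blast
      then show ?thesis
      proof cases
        case a: 1
        have "stuck d" using yz(3) \<open>y = u\<close> a 1 dist by (auto simp: stuck_def c0_def)
        then show ?thesis by simp
      next
        case a: 2
        have "z \<noteq> x" "z \<noteq> w" "z \<noteq> u" using a T wT yz' \<open>y = u\<close> by auto
        then have "one_mobile d" unfolding one_mobile_def yz(3)
          using \<open>y = u\<close> a 1 dist by (intro conjI bexI[OF _ a]) (auto simp: c0_def)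
        then show ?thesis by simp
      qed
    next
      case 2
      then obtain t where t: "t \<in> T" "c t \<le> 2" "\<And>z. z \<noteq> t \<Longrightarrow> c z \<le> 1" "c w = 0" "c x = 0"
        by (auto simp: one_mobile_def)
      have "y = t" using yz(2) t(3)[of y] by fastforce
      then consider "z = x" | "z \<in> T" using target t yz(1) by blast
      then show ?thesis
      proof cases
        case a: 1
        have "stuck d" using yz(3) \<open>y = t\<close> a t dist by (auto simp: stuck_def)
        then show ?thesis by simp
      next
        case a: 2
        have "z \<noteq> x" "z \<noteq> w" "z \<noteq> t" "t \<noteq> x" "t \<noteq> w" using a T wT yz' \<open>y = t\<close> t by auto
        then have "one_mobile d" unfolding one_mobile_def yz(3)
          using \<open>y = t\<close> a t by (intro conjI bexI[OF _ a]) (auto simp: le_Suc_eq)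
        then show ?thesis by simp
      qed
    next
      case 3
      then have "c y \<le> 1" by (simp add: stuck_def)
      then show ?thesis using yz(2) by simp
    qed
  qed
  moreover have "c0 w = 0" using dist by (simp add: c0_def)
  ultimately show "\<not> solvable G w c0"
    unfolding solvable_def by (fastforce simp: one_mobile_def stuck_def)
qed

lemma class_0_no_cut_vertex:
  assumes G: "pair_graph G" and d: "diameter G = 2" and c0: "class_0 G"
  shows "\<not> has_cut_vertex G"
proof
  assume "has_cut_vertex G"
  then obtain x where x: "cut_vertex G x" by (auto simp: has_cut_vertex_def)
  interpret simple_graph "pverts G" "parcs G" by (rule pair_graph_simple_graph[OF G])
  have "\<not> connected_on (pverts G - {x})"
    using x connected_del_vert_iff[OF G] by (auto simp: cut_vertex_def)
  then obtain T where T: "T \<subseteq> pverts G - {x}" "T \<noteq> {}" "T \<noteq> pverts G - {x}"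
    "\<And>y z. y \<in> T \<Longrightarrow> z \<in> pverts G - {x} - T \<Longrightarrow> (y, z) \<notin> parcs G"
    unfolding connected_on_def by blast
  then obtain u w where uw: "u \<in> T" "w \<in> pverts G - {x} - T" by blast
  have xV: "x \<in> pverts G" using x by (simp add: cut_vertex_def)
  let ?Q = "\<lambda>k. \<forall>r\<in>pverts G. \<forall>c. config_size G c = k \<longrightarrow> solvable G r c"
  have "?Q (4 * card (pverts G))" using solvable_if_4n_pebbles[OF G d] by blast
  then have "?Q (pebbling_number G)" unfolding pebbling_number_def by (rule LeastI)
  then have "?Q (card (pverts G))" using c0 by (simp add: class_0_def)
  then show False
    using cut_vertex_unsolvable[OF G xV T(1) uw T(4)] uw(2) by blast
qed

section \<open>The extremal graphs\<close>

lemma extremal_families_count: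
  assumes "digraph_iso (with_proj G) (with_proj petersen) \<or>
    (\<exists>p q. p > 0 \<and> q > 0 \<and> digraph_iso (with_proj G) (with_proj (F_graph p q))) \<or>
    (\<exists>p q r. p > 0 \<and> q > 0 \<and> r > 0 \<and> digraph_iso (with_proj G) (with_proj (G_graph p q r)))"
  shows "4 * card (pverts G) = card (parcs G) + 10"
  using assms
proof (elim disjE exE conjE)
  assume "digraph_iso (with_proj G) (with_proj petersen)"
  from digraph_iso_same_counts[OF this] show ?thesis by (simp add: card_petersen)
next
  fix p q assume "digraph_iso (with_proj G) (with_proj (F_graph p q))"
  from digraph_iso_same_counts[OF this] show ?thesis
    by (simp add: F_graph_eq_hub_graph card_pverts_hub_graph card_parcs_hub_graph)
next
  fix p q r assume "digraph_iso (with_proj G) (with_proj (G_graph p q r))"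
  from digraph_iso_same_counts[OF this] show ?thesis
    by (simp add: G_graph_eq_hub_graph card_pverts_hub_graph card_parcs_hub_graph)
qed

lemma extremal_families_characterisation:
  assumes G: "pair_graph G" and d: "diameter G = 2" and nc: "\<not> has_cut_vertex G"
    and eq: "4 * card (pverts G) = card (parcs G) + 10"
  shows "digraph_iso (with_proj G) (with_proj petersen) \<or>
    (\<exists>p q. p > 0 \<and> q > 0 \<and> digraph_iso (with_proj G) (with_proj (F_graph p q))) \<or>
    (\<exists>p q r. p > 0 \<and> q > 0 \<and> r > 0 \<and> digraph_iso (with_proj G) (with_proj (G_graph p q r)))"
proof -
  interpret biconnected_diameter_two "pverts G" "parcs G"
    by (rule biconnected_diameter_twoI[OF G d nc])
  have pos: "card (P j) > 0" if "hub_structure k w P" "j \<in> {1..k}" for k w P j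
  proof -
    have "P j \<noteq> {}" "P j \<subseteq> pverts G" using that unfolding hub_structure_def by blast+
    then show ?thesis using finite_V by (simp add: card_gt_0_iff finite_subset)
  qed
  consider w P where "hub_structure 2 w P" | w P where "hub_structure 3 w P" | "petersen_structure"
    using arc_bound_equality[OF eq] by blast
  then show ?thesis
  proof cases
    case (1 w P)
    have "hub_graph 2 (\<lambda>j. card (P j)) = F_graph (card (P 1)) (card (P 2))"
      unfolding F_graph_eq_hub_graph by (rule hub_graph_cong) (auto simp: numeral_2_eq_2 le_Suc_eq)
    then have "digraph_iso (with_proj G) (with_proj (F_graph (card (P 1)) (card (P 2))))"
      using digraph_iso_hub_graph[OF G _ _ 1] eq by simp
    then show ?thesis using pos[OF 1] by (metis atLeastAtMost_iff one_le_numeral order_refl)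
  next
    case (2 w P)
    have "hub_graph 3 (\<lambda>j. card (P j)) = G_graph (card (P 1)) (card (P 2)) (card (P 3))"
      unfolding G_graph_eq_hub_graph by (rule hub_graph_cong) (auto simp: numeral_2_eq_2 numeral_3_eq_3 le_Suc_eq)
    then have "digraph_iso (with_proj G) (with_proj (G_graph (card (P 1)) (card (P 2)) (card (P 3))))"
      using digraph_iso_hub_graph[OF G _ _ 2] eq by simp
    moreover have "card (P 1) > 0" "card (P 2) > 0" "card (P 3) > 0"
      by (rule pos[OF 2], simp)+
    ultimately show ?thesis by blast
  next
    case 3
    then have "card (pverts G) = 10" by (simp add: petersen_structure_def)
    then have "card (parcs G) = 30" using eq by simp
    then show ?thesis using digraph_iso_petersen[OF G _ 3] by blast
  qed
qed

theorem theorem5: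
  fixes G :: "'a pair_pre_digraph" and n :: nat
  assumes "pair_graph G" and "connected (with_proj G)"
    and "card (pverts G) = n" and "diameter G = 2"
  shows "(class_0 G \<longrightarrow> \<not> has_cut_vertex G) \<and>
    (\<not> has_cut_vertex G \<longrightarrow>
       int (card (edges G)) \<ge> 2 * int n - 5 \<and>
       (int (card (edges G)) = 2 * int n - 5 \<longleftrightarrow>
          digraph_iso (with_proj G) (with_proj petersen) \<or>
          (\<exists>p q. p > 0 \<and> q > 0 \<and> digraph_iso (with_proj G) (with_proj (F_graph p q))) \<or>
          (\<exists>p q r. p > 0 \<and> q > 0 \<and> r > 0 \<and>
             digraph_iso (with_proj G) (with_proj (G_graph p q r)))))"
proof (intro conjI impI)
  show "\<not> has_cut_vertex G" if "class_0 G"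
    using class_0_no_cut_vertex[OF assms(1,4) that] .
  assume nc: "\<not> has_cut_vertex G"
  interpret biconnected_diameter_two "pverts G" "parcs G"
    by (rule biconnected_diameter_twoI[OF assms(1,4) nc])
  note arcs = card_parcs[OF assms(1)]
  show "int (card (edges G)) \<ge> 2 * int n - 5"
    using arc_bound arcs assms(3) by simp
  have "int (card (edges G)) = 2 * int n - 5 \<longleftrightarrow> 4 * card (pverts G) = card (parcs G) + 10"
    using arcs assms(3) by auto
  then show "int (card (edges G)) = 2 * int n - 5 \<longleftrightarrow>
          digraph_iso (with_proj G) (with_proj petersen) \<or>
          (\<exists>p q. p > 0 \<and> q > 0 \<and> digraph_iso (with_proj G) (with_proj (F_graph p q))) \<or>
          (\<exists>p q r. p > 0 \<and> q > 0 \<and> r > 0 \<and>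
             digraph_iso (with_proj G) (with_proj (G_graph p q r)))"
    using extremal_families_characterisation[OF assms(1,4) nc] extremal_families_count by blast
qed

end
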